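(* Let $f\in\mathcal F$ and let $g(\lambda)=h(\lambda)\,t_1(\lambda)/t_2(\lambda)$, $\lambda\in\Lambda$, where $h\in B_+^-$ and $t_1,t_2$ are nonnegative trigonometric polynomials, not identically zero, such that $fg\in L^1(\Lambda)$. Then $g\in\mathcal M_f$ and $fg\in\mathcal F$; in particular $$\lim_{n\to\infty}\frac{\sigma_n^2(fg)}{\sigma_n^2(f)}=G(g).$$
   Context: $\Lambda=[-\pi,\pi]$. For $h\ge0$, $G(h)=\exp\{\frac1{2\pi}\int_\Lambda\ln h\,d\lambda\}$ if $\ln h\in L^1(\Lambda)$, else $G(h)=0$. For a spectral density $f$, $\sigma_n^2(f)=\min_{c_1,\dots,c_n\in\mathbb C}\int_\Lambda|1-\sum_{k=1}^n c_ke^{-ik\lambda}|^2f(\lambda)\,d\lambda$, $\sigma_n(f)=\sqrt{\sigma_n^2(f)}$. $\mathcal F=\{f\in L^1(\Lambda): f\ge0,\ G(f)=0,\ \lim_{n\to\infty}\sigma_{n+1}(f)/\sigma_n(f)=1\}$. For $f\in\mathcal F$, $\mathcal M_f=\{g\ge0: G(g)>0,\ fg\in L^1(\Lambda),\ \lim_{n}\sigma_n^2(fg)/\sigma_n^2(f)=G(g)\}$. $B$ = nonnegative Riemann integrable functions on $\Lambda$; $B_+^-=\{h\in B: m\le h\le M\text{ for some constants }0<m\le M\}$. A trigonometric polynomial is $t(\lambda)=\sum_{k=-\nu}^{\nu}c_ke^{ik\lambda}$ (real-valued). *)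

theory Defs
  imports "HOL-Analysis.Analysis"
begin

definition Lam :: "real set" where
  "Lam = {-pi..pi}"

definition L1 :: "(real \<Rightarrow> real) \<Rightarrow> bool" where
  "L1 h \<longleftrightarrow> set_integrable lebesgue Lam h"

definition Lint :: "(real \<Rightarrow> real) \<Rightarrow> real" where
  "Lint h = (LINT x:Lam|lebesgue. h x)"

text \<open>Geometric mean G(h). ln h in L^1 includes that h > 0 a.e. (ln 0 = -infinity);
  since Isabelle's ln 0 = 0 this positivity is made explicit.\<close>
definition G :: "(real \<Rightarrow> real) \<Rightarrow> real" where
  "G h = (if (AE x in lebesgue. x \<in> Lam \<longrightarrow> h x > 0) \<and> L1 (\<lambda>x. ln (h x))
          then exp (1 / (2 * pi) * Lint (\<lambda>x. ln (h x))) else 0)"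

definition sigma2 :: "(real \<Rightarrow> real) \<Rightarrow> nat \<Rightarrow> real" where
  "sigma2 f n = Inf ((\<lambda>c::nat \<Rightarrow> complex.
      Lint (\<lambda>x. (cmod (1 - (\<Sum>k=1..n. c k * exp (- \<i> * of_nat k * of_real x))))\<^sup>2 * f x)) ` UNIV)"

definition sigma :: "(real \<Rightarrow> real) \<Rightarrow> nat \<Rightarrow> real" where
  "sigma f n = sqrt (sigma2 f n)"

definition classF :: "(real \<Rightarrow> real) set" where
  "classF = {f. L1 f \<and> (\<forall>x\<in>Lam. f x \<ge> 0) \<and> G f = 0 \<and>
                 (\<lambda>n. sigma f (Suc n) / sigma f n) \<longlonglongrightarrow> 1}"

definition classM :: "(real \<Rightarrow> real) \<Rightarrow> (real \<Rightarrow> real) set" where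
  "classM f = {g. (\<forall>x\<in>Lam. g x \<ge> 0) \<and> G g > 0 \<and> L1 (\<lambda>x. f x * g x) \<and>
                 (\<lambda>n. sigma2 (\<lambda>x. f x * g x) n / sigma2 f n) \<longlonglongrightarrow> G g}"

text \<open>Riemann integrability on [a,b] (Riemann/Darboux criterion): bounded, and for every
  e > 0 there is a partition a = x_0 < ... < x_m = b whose upper minus lower Darboux
  sum is < e.\<close>
definition riemann_integrable_on :: "(real \<Rightarrow> real) \<Rightarrow> real \<Rightarrow> real \<Rightarrow> bool" where
  "riemann_integrable_on h a b \<longleftrightarrow> bounded (h ` {a..b}) \<and>
     (\<forall>e>0. \<exists>xs::real list. length xs \<ge> 2 \<and> sorted_wrt (<) xs \<and> hd xs = a \<and> last xs = b \<and>
        (\<Sum>i<length xs - 1.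
           (Sup (h ` {xs!i..xs!(Suc i)}) - Inf (h ` {xs!i..xs!(Suc i)})) * (xs!(Suc i) - xs!i)) < e)"

definition classB :: "(real \<Rightarrow> real) set" where
  "classB = {h. riemann_integrable_on h (-pi) pi \<and> (\<forall>x\<in>Lam. h x \<ge> 0)}"

definition classBpm :: "(real \<Rightarrow> real) set" where
  "classBpm = {h. h \<in> classB \<and> (\<exists>m M. 0 < m \<and> m \<le> M \<and> (\<forall>x\<in>Lam. m \<le> h x \<and> h x \<le> M))}"

definition trig_poly :: "(real \<Rightarrow> real) \<Rightarrow> bool" where
  "trig_poly t \<longleftrightarrow> (\<exists>(\<nu>::nat) (c::int \<Rightarrow> complex). \<forall>x\<in>Lam.
      complex_of_real (t x) = (\<Sum>k\<in>{-int \<nu>..int \<nu>}. c k * exp (\<i> * of_int k * of_real x)))"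

end

theory Submission
  imports Defs "HOL-Computational_Algebra.Polynomial"
begin

text \<open>Write \<open>z = exp (-i x)\<close>. Then \<open>\<sigma>\<^sub>n\<^sup>2(f)\<close> is the infimum of \<open>\<integral> |p(z)|\<^sup>2 f\<close> over the polynomials \<open>p\<close> of
  degree at most \<open>n\<close> with \<open>p(0) = 1\<close>. Hence, if \<open>p\<close> has degree at most \<open>m\<close> and \<open>|p(z)|\<^sup>2 F \<le> F'\<close> almost
  everywhere, multiplication by \<open>p\<close> gives \<open>|p(0)|\<^sup>2 \<sigma>\<^sub>n\<^sub>+\<^sub>m\<^sup>2(F) \<le> \<sigma>\<^sub>n\<^sup>2(F')\<close>. As \<open>\<sigma>\<^sub>n\<^sub>+\<^sub>m(f) / \<sigma>\<^sub>n(f) \<longlongrightarrow> 1\<close>,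
  it suffices to find polynomials \<open>p\<close> and \<open>q\<close> with \<open>|p|\<^sup>2 \<le> g\<close>, \<open>|q|\<^sup>2 \<le> 1/g\<close> and with \<open>|p(0)|\<^sup>2\<close>, \<open>|q(0)|\<^sup>2\<close>
  arbitrarily close to \<open>G(g)\<close>, \<open>1/G(g)\<close>.

  Splitting off the zeros of \<open>t\<^sub>1\<close> and \<open>t\<^sub>2\<close> on the circle, \<open>g = exp H |A|\<^sup>2 / |B|\<^sup>2\<close> where \<open>A\<close>, \<open>B\<close> are products of
  factors \<open>z - \<zeta>\<close> with \<open>|\<zeta>| = 1\<close> and \<open>H\<close> is bounded and continuous almost everywhere. The factor
  \<open>A\<close> is itself a polynomial; \<open>1/B\<close> is replaced by a truncated geometric series of \<open>1 / (1 - r \<zeta>\<^sup>-\<^sup>1 z)\<close>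
  with \<open>r < 1\<close>; and \<open>exp H\<close> is approximated from below by \<open>|exp (P/2)|\<^sup>2\<close>, where \<open>Re P \<le> H\<close> comes from the
  Stone-Weierstrass theorem and \<open>Re P(0)\<close> is the mean of \<open>Re P\<close>. Since \<open>ln |A|\<close> and \<open>ln |B|\<close> have
  mean \<open>0\<close>, \<open>G(g)\<close> is the exponential of the mean of \<open>H\<close>.\<close>

section \<open>Prediction errors as infima over polynomials\<close>

abbreviation LM :: "real measure" where "LM \<equiv> lebesgue_on Lam"

lemma Lam_sets [simp]: "Lam \<in> sets lebesgue"
  by (simp add: Lam_def)

lemma L1_iff: "L1 h \<longleftrightarrow> integrable LM h"
  by (simp add: L1_def set_integrable_def integrable_restrict_space)

lemma Lint_eq: "Lint h = integral\<^sup>L LM h"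
  by (simp add: Lint_def set_lebesgue_integral_def integral_restrict_space)

lemma AE_LM_iff: "(AE x in LM. P x) \<longleftrightarrow> (AE x in lebesgue. x \<in> Lam \<longrightarrow> P x)"
  by (simp add: AE_restrict_space_iff)

lemma measure_LM: "measure LM Lam = 2 * pi"
  by (simp add: measure_restrict_space Lam_def)

interpretation LM: finite_measure LM
  by (rule finite_measureI) (simp add: emeasure_restrict_space Lam_def)

lemma continuous_measurable_LM:
  fixes u :: "real \<Rightarrow> 'b::euclidean_space"
  shows "continuous_on Lam u \<Longrightarrow> u \<in> borel_measurable LM"
  by (rule continuous_imp_measurable_on_sets_lebesgue) auto

lemma continuous_integrable_LM:
  fixes u :: "real \<Rightarrow> real"
  assumes "continuous_on Lam u"
  shows "integrable LM u"
proof -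
  have "compact (u ` Lam)"
    using assms by (intro compact_continuous_image) (auto simp: Lam_def)
  then obtain C where "\<And>x. x \<in> Lam \<Longrightarrow> norm (u x) \<le> C"
    using compact_imp_bounded bounded_iff by (metis imageI)
  then show ?thesis
    by (intro LM.integrable_const_bound[of _ C] continuous_measurable_LM assms AE_I2) auto
qed

text \<open>Lebesgue measure is complete: extension by \<open>0\<close> moves the question to the
  whole line, where a function equal almost everywhere to a measurable one is measurable.\<close>

lemma measurable_LM_AE:
  fixes u v :: "real \<Rightarrow> real"
  assumes "u \<in> borel_measurable LM" "AE x in LM. u x = v x"
  shows "v \<in> borel_measurable LM"
proof -
  have "AE x in lebesgue. (if x \<in> Lam then u x else 0) = (if x \<in> Lam then v x else 0)"
    using assms(2) unfolding AE_LM_iff by eventually_elim auto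
  with borel_measurable_if_I[OF assms(1) Lam_sets] show ?thesis
    by (rule borel_measurable_if_D[OF borel_measurable_AE])
qed

lemma integrable_LM_AE:
  fixes u v :: "real \<Rightarrow> real"
  assumes "integrable LM u" "AE x in LM. u x = v x"
  shows "integrable LM v" "integral\<^sup>L LM v = integral\<^sup>L LM u"
proof -
  have v: "v \<in> borel_measurable LM"
    using measurable_LM_AE[of u v] assms by blast
  show "integrable LM v" using assms(1) v assms(2) by (rule integrable_cong_AE_imp)
  show "integral\<^sup>L LM v = integral\<^sup>L LM u"
    using assms v by (intro integral_cong_AE) auto
qed

lemma poly_cis_bounded:
  obtains C where "C > 0" "\<And>x. (cmod (poly p (cis (-x))))\<^sup>2 \<le> C"
proof -
  have "compact (poly p ` sphere 0 1)"
    by (intro compact_continuous_image continuous_intros) auto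
  then obtain C where C: "\<And>z. z \<in> sphere 0 1 \<Longrightarrow> cmod (poly p z) \<le> C"
    using compact_imp_bounded bounded_iff by (metis imageI)
  have "cmod (poly p (cis (-x))) \<le> C" for x
    by (rule C) simp
  then have "(cmod (poly p (cis (-x))))\<^sup>2 \<le> (max C 1)\<^sup>2" for x
    by (intro power_mono) (auto simp: le_max_iff_disj)
  moreover have "(max C 1)\<^sup>2 > 0" by simp
  ultimately show ?thesis using that by blast
qed

lemma integrable_poly_weight:
  assumes "integrable LM F"
  shows "integrable LM (\<lambda>x. (cmod (poly p (cis (-x))))\<^sup>2 * F x)"
proof -
  obtain C where C: "C > 0" "\<And>x. (cmod (poly p (cis (-x))))\<^sup>2 \<le> C"
    using poly_cis_bounded by blast
  show ?thesis
  proof (rule Bochner_Integration.integrable_bound[of _ "\<lambda>x. C * F x"])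
    show "(\<lambda>x. (cmod (poly p (cis (-x))))\<^sup>2 * F x) \<in> borel_measurable LM"
      by (rule borel_measurable_times, intro continuous_measurable_LM continuous_intros)
        (use assms in auto)
  qed (use assms C in \<open>auto simp: abs_mult intro!: mult_right_mono\<close>)
qed

text \<open>With \<open>z = cis (-x)\<close> the competitors are exactly the polynomials with
  constant coefficient \<open>1\<close>, whose other coefficients are the \<open>- c k\<close>. In
  this form they can be multiplied.\<close>

lemma sigma2_eq_Inf_poly:
  "sigma2 F n = (INF p\<in>{p. degree p \<le> n \<and> poly p 0 = 1}.
      integral\<^sup>L LM (\<lambda>x. (cmod (poly p (cis (-x))))\<^sup>2 * F x))"
proof -
  define I where "I u = integral\<^sup>L LM (\<lambda>x. (cmod (u (cis (-x))))\<^sup>2 * F x)" for u :: "complex \<Rightarrow> complex"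
  have e: "exp (- \<i> * of_nat k * of_real x) = cis (-x) ^ k" for k x
    by (simp add: cis_conv_exp exp_of_nat_mult[symmetric] mult_ac)
  have "range (\<lambda>c. I (\<lambda>z. 1 - (\<Sum>k=1..n. c k * z ^ k))) = (\<lambda>p. I (poly p)) ` {p. degree p \<le> n \<and> poly p 0 = 1}"
    (is "?A = ?B")
  proof safe
    fix c :: "nat \<Rightarrow> complex"
    let ?p = "1 - (\<Sum>k=1..n. monom (c k) k)"
    have "poly ?p = (\<lambda>z. 1 - (\<Sum>k=1..n. c k * z ^ k))"
      by (auto simp: poly_sum poly_monom fun_eq_iff)
    moreover have "degree ?p \<le> n"
      by (intro degree_diff_le degree_sum_le) (auto intro: order_trans[OF degree_monom_le])
    moreover have "poly ?p 0 = 1" by (simp add: poly_sum poly_monom)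
    ultimately show "I (\<lambda>z. 1 - (\<Sum>k=1..n. c k * z ^ k)) \<in> ?B"
      by (intro image_eqI[of _ _ ?p]) auto
  next
    fix p :: "complex poly" assume p: "degree p \<le> n" "poly p 0 = 1"
    have "poly p z = 1 - (\<Sum>k=1..n. (- coeff p k) * z ^ k)" for z
    proof -
      have "poly p z = (\<Sum>k\<le>n. coeff p k * z ^ k)"
        unfolding poly_altdef using p(1)
        by (intro sum.mono_neutral_left) (auto simp: coeff_eq_0)
      also have "\<dots> = coeff p 0 + (\<Sum>k=1..n. coeff p k * z ^ k)"
        by (simp add: atMost_atLeast0 sum.atLeast_Suc_atMost)
      finally show ?thesis using p(2) by (simp add: poly_0_coeff_0 sum_negf)
    qed
    then have "poly p = (\<lambda>z. 1 - (\<Sum>k=1..n. (- coeff p k) * z ^ k))" by blast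
    then show "I (poly p) \<in> ?A" by (intro image_eqI[of _ _ "\<lambda>k. - coeff p k"]) auto
  qed
  then show ?thesis
    unfolding sigma2_def Lint_eq e I_def by simp
qed

lemma sigma2_bdd_below:
  assumes "\<And>x. x \<in> Lam \<Longrightarrow> F x \<ge> 0"
  shows "bdd_below ((\<lambda>p. integral\<^sup>L LM (\<lambda>x. (cmod (poly p (cis (-x))))\<^sup>2 * F x)) ` S)"
  using assms by (intro bdd_belowI[of _ 0]) (auto intro!: integral_nonneg_AE AE_I2)

lemma sigma2_nonneg:
  assumes "\<And>x. x \<in> Lam \<Longrightarrow> F x \<ge> 0"
  shows "sigma2 F n \<ge> 0"
  unfolding sigma2_eq_Inf_poly
  by (rule cINF_greatest) (use assms in \<open>auto intro!: integral_nonneg_AE AE_I2 exI[of _ 1]\<close>)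

text \<open>If \<open>r\<close> competes for \<open>F2\<close> at degree \<open>n\<close>, then
  \<open>r * p\<close>, divided by its value at \<open>0\<close>, competes for \<open>F1\<close> at
  degree \<open>n + m\<close>. All comparisons of errors for different weights rest on this.\<close>

lemma sigma2_transfer:
  assumes F1: "integrable LM F1" "\<And>x. x \<in> Lam \<Longrightarrow> F1 x \<ge> 0" and F2: "integrable LM F2"
    and p: "degree p \<le> m" "poly p 0 \<noteq> 0"
    and le: "AE x in LM. (cmod (poly p (cis (-x))))\<^sup>2 * F1 x \<le> F2 x"
  shows "(cmod (poly p 0))\<^sup>2 * sigma2 F1 (n + m) \<le> sigma2 F2 n"
  unfolding sigma2_eq_Inf_poly[of F2]
proof (rule cINF_greatest)
  show "{p::complex poly. degree p \<le> n \<and> poly p 0 = 1} \<noteq> {}"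
    by (auto intro!: exI[of _ 1])
next
  fix r :: "complex poly" assume r: "r \<in> {p. degree p \<le> n \<and> poly p 0 = 1}"
  define c where "c = (cmod (poly p 0))\<^sup>2"
  have c: "c > 0" using p by (simp add: c_def)
  define q where "q = smult (inverse (poly p 0)) (r * p)"
  have "degree q \<le> n + m"
    using r p degree_mult_le[of r p] by (auto simp: q_def)
  moreover have "poly q 0 = 1" using r p by (simp add: q_def)
  ultimately have "sigma2 F1 (n + m) \<le> integral\<^sup>L LM (\<lambda>x. (cmod (poly q (cis (-x))))\<^sup>2 * F1 x)"
    unfolding sigma2_eq_Inf_poly using F1(2) by (intro cINF_lower sigma2_bdd_below) auto
  then have "c * sigma2 F1 (n + m) \<le> c * integral\<^sup>L LM (\<lambda>x. (cmod (poly q (cis (-x))))\<^sup>2 * F1 x)"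
    using c by simp
  also have "\<dots> = integral\<^sup>L LM (\<lambda>x. c * ((cmod (poly q (cis (-x))))\<^sup>2 * F1 x))"
    by simp
  also have "\<dots> \<le> integral\<^sup>L LM (\<lambda>x. (cmod (poly r (cis (-x))))\<^sup>2 * F2 x)"
  proof (rule integral_mono_AE)
    show "AE x in LM. c * ((cmod (poly q (cis (-x))))\<^sup>2 * F1 x) \<le> (cmod (poly r (cis (-x))))\<^sup>2 * F2 x"
      using le
    proof eventually_elim
      case (elim x)
      have "c * ((cmod (poly q (cis (-x))))\<^sup>2 * F1 x) = 
        (cmod (poly r (cis (-x))))\<^sup>2 * ((cmod (poly p (cis (-x))))\<^sup>2 * F1 x)"
        using p(2) by (simp add: q_def c_def norm_mult norm_inverse power_mult_distrib power_inverse)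
      also have "\<dots> \<le> (cmod (poly r (cis (-x))))\<^sup>2 * F2 x"
        using elim by (rule mult_left_mono) simp
      finally show ?case .
    qed
  qed (use F1 F2 in \<open>auto intro!: integrable_poly_weight\<close>)
  finally show "(cmod (poly p 0))\<^sup>2 * sigma2 F1 (n + m)
      \<le> integral\<^sup>L LM (\<lambda>x. (cmod (poly r (cis (-x))))\<^sup>2 * F2 x)" by (simp add: c_def)
qed

section \<open>Mean values over the unit circle\<close>

lemma integral_Re_monom_cis:
  "integral\<^sup>L LM (\<lambda>x. Re (c * cis (-x) ^ k)) = (if k = 0 then 2 * pi * Re c else 0)"
proof (cases "k = 0")
  case True
  then show ?thesis by (simp add: measure_LM)
next
  case False
  \<comment> \<open>For \<open>k > 0\<close> the antiderivative has period \<open>2 * pi\<close>, so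
    its values at the two endpoints cancel.\<close>
  have d: "((\<lambda>x. Re (c * \<i> / of_nat k * cis (- (real k * x)))) has_vector_derivative Re (c * cis (-x) ^ k))
      (at x within {-pi..pi})" for x
    unfolding Complex.DeMoivre using False
    by (auto intro!: derivative_eq_intros simp: has_real_derivative_iff_has_vector_derivative[symmetric]
        field_simps)
  have "((\<lambda>x. Re (c * cis (-x) ^ k)) has_integral 0) {-pi..pi}"
    using fundamental_theorem_of_calculus[OF _ d] by (simp add: cis.ctr)
  then have "integral Lam (\<lambda>x. Re (c * cis (-x) ^ k)) = 0"
    by (simp add: Lam_def integral_unique)
  moreover have "integrable LM (\<lambda>x. Re (c * cis (-x) ^ k))"
    by (intro continuous_integrable_LM continuous_intros)
  ultimately show ?thesis using False by (simp add: lebesgue_integral_eq_integral)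
qed

text \<open>Mean value property: only the constant coefficient survives the integration.\<close>

lemma integral_Re_poly_cis:
  "integral\<^sup>L LM (\<lambda>x. Re (poly p (cis (-x)))) = 2 * pi * Re (poly p 0)"
proof -
  have "integral\<^sup>L LM (\<lambda>x. Re (poly p (cis (-x)))) =
      integral\<^sup>L LM (\<lambda>x. \<Sum>k\<le>degree p. Re (coeff p k * cis (-x) ^ k))"
    by (simp only: poly_altdef Re_sum)
  also have "\<dots> = (\<Sum>k\<le>degree p. integral\<^sup>L LM (\<lambda>x. Re (coeff p k * cis (-x) ^ k)))"
    by (intro Bochner_Integration.integral_sum continuous_integrable_LM continuous_intros)
  also have "\<dots> = 2 * pi * Re (poly p 0)"
    unfolding integral_Re_monom_cis by (simp add: poly_0_coeff_0)
  finally show ?thesis .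
qed

section \<open>Polynomial approximation on the unit circle\<close>

text \<open>Product-to-sum formula: \<open>2 * Re a * Re b = Re (a * b + cnj a * b)\<close>, and on
  the circle \<open>cnj z\<close> is the inverse of \<open>z\<close>. The order
  \<open>k \<le> l\<close> keeps the exponent \<open>l - k\<close> a true difference, so no negative
  power arises.\<close>

lemma Re_monom_mult_Re_monom:
  assumes "cmod z = 1" "k \<le> l"
  shows "Re (c * z ^ k) * Re (d * z ^ l) = Re (c * d / 2 * z ^ (k + l) + cnj c * d / 2 * z ^ (l - k))"
proof -
  have zz: "cnj z * z = 1"
    using assms(1) by (metis complex_norm_square mult.commute of_real_1 power_one)
  have "cnj (z ^ k) * z ^ l = (cnj z * z) ^ k * z ^ (l - k)"
    using assms(2) by (simp add: power_mult_distrib flip: power_add)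
  then have e: "cnj (z ^ k) * z ^ l = z ^ (l - k)" by (simp add: zz)
  have "Re a * Re b = Re (a * b / 2 + cnj a * b / 2)" for a b
    by (simp add: field_simps)
  from this[of "c * z ^ k" "d * z ^ l"]
  have "Re (c * z ^ k) * Re (d * z ^ l) =
    Re (c * d / 2 * (z ^ k * z ^ l) + cnj c * d / 2 * (cnj (z ^ k) * z ^ l))"
    by (simp only: complex_cnj_mult mult_ac times_divide_eq_right times_divide_eq_left)
  then show ?thesis by (simp only: e power_add)
qed

text \<open>Expanding both factors reduces the claim to monomials. It shows that the real parts of
  polynomials form an algebra on the circle.\<close>

lemma Re_poly_mult_Re_poly:
  fixes p q :: "complex poly"
  obtains r where "\<And>z. cmod z = 1 \<Longrightarrow> Re (poly p z) * Re (poly q z) = Re (poly r z)"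
proof -
  have "\<exists>r. \<forall>z. cmod z = 1 \<longrightarrow> Re (c * z ^ k) * Re (d * z ^ l) = Re (poly r z)" for c d k l
  proof (cases "k \<le> l")
    case True
    then show ?thesis
      by (intro exI[of _ "monom (c * d / 2) (k + l) + monom (cnj c * d / 2) (l - k)"])
        (auto simp only: Re_monom_mult_Re_monom poly_monom poly_add)
  next
    case False
    then show ?thesis
      by (intro exI[of _ "monom (d * c / 2) (l + k) + monom (cnj d * c / 2) (k - l)"])
        (auto simp only: Re_monom_mult_Re_monom[of _ l k d c] mult.commute[of "Re (c * _)"]
           linorder_not_le less_imp_le poly_monom poly_add)
  qed
  \<comment> \<open>The polynomial is chosen as a function of coefficients and exponents, so that
    one double sum serves all \<open>z\<close>.\<close>
  then have "\<forall>c d k l. \<exists>r. \<forall>z. cmod z = 1 \<longrightarrow> Re (c * z ^ k) * Re (d * z ^ l) = Re (poly r z)"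
    by blast
  then obtain R where R: "\<And>c d k l z. cmod z = 1 \<Longrightarrow>
      Re (c * z ^ k) * Re (d * z ^ l) = Re (poly (R c d k l) z)"
    unfolding choice_iff by blast
  let ?r = "\<Sum>k\<le>degree p. \<Sum>l\<le>degree q. R (coeff p k) (coeff q l) k l"
  have "Re (poly p z) * Re (poly q z) = Re (poly ?r z)" if "cmod z = 1" for z
  proof -
    have "Re (poly p z) * Re (poly q z) =
        (\<Sum>k\<le>degree p. \<Sum>l\<le>degree q. Re (coeff p k * z ^ k) * Re (coeff q l * z ^ l))"
      by (simp only: poly_altdef Re_sum sum_product)
    also have "\<dots> = Re (poly ?r z)"
      by (simp only: R[OF that] poly_sum Re_sum)
    finally show ?thesis .
  qed
  then show ?thesis using that by blast
qed

text \<open>Polynomials in \<open>Re z\<close> and \<open>Im z\<close> are built from linear maps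
  and constants by sums and products; only products use that \<open>z\<close> lies on the
  circle.\<close>

lemma real_polynomial_function_circle:
  fixes g :: "complex \<Rightarrow> real"
  assumes "real_polynomial_function g"
  shows "\<exists>p. \<forall>z. cmod z = 1 \<longrightarrow> g z = Re (poly p z)"
  using assms
proof (induction rule: real_polynomial_function.induct)
  case (linear g)
  interpret bounded_linear g by fact
  \<comment> \<open>A real-linear map is determined by its values at \<open>1\<close> and
    \<open>\<i>\<close>; the sign of the imaginary part compensates
    \<open>\<i> * \<i> = -1\<close>.\<close>
  have "g z = Re (poly [:0, Complex (g 1) (- g \<i>):] z)" for z
  proof -
    have "g z = g (Re z *\<^sub>R 1 + Im z *\<^sub>R \<i>)" 
      by (rule arg_cong[of _ _ g]) (simp add: complex_eq_iff)
    also have "\<dots> = Re z * g 1 + Im z * g \<i>" by (simp only: add scaleR real_scaleR_def)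
    finally show ?thesis by (simp add: algebra_simps)
  qed
  then show ?case by blast
next
  case (const c)
  show ?case by (rule exI[of _ "[:of_real c:]"]) simp
next
  case (add f g)
  then obtain p q where "\<forall>z. cmod z = 1 \<longrightarrow> f z = Re (poly p z)" "\<forall>z. cmod z = 1 \<longrightarrow> g z = Re (poly q z)"
    by blast
  then show ?case by (intro exI[of _ "p + q"]) simp
next
  case (mult f g)
  then obtain p q where pq: "\<forall>z. cmod z = 1 \<longrightarrow> f z = Re (poly p z)" "\<forall>z. cmod z = 1 \<longrightarrow> g z = Re (poly q z)"
    by blast
  obtain r where "\<And>z. cmod z = 1 \<Longrightarrow> Re (poly p z) * Re (poly q z) = Re (poly r z)"
    using Re_poly_mult_Re_poly[of p q] by blast
  then show ?case using pq by (intro exI[of _ r]) simp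
qed

lemma Stone_Weierstrass_circle:
  fixes U :: "complex \<Rightarrow> real"
  assumes "continuous_on (sphere 0 1) U" "e > 0"
  obtains p where "\<And>z. cmod z = 1 \<Longrightarrow> \<bar>U z - Re (poly p z)\<bar> < e"
proof -
  obtain g where g: "real_polynomial_function g" "\<And>z. z \<in> sphere 0 1 \<Longrightarrow> \<bar>U z - g z\<bar> < e"
    using Stone_Weierstrass_real_polynomial_function[OF _ assms] by auto
  obtain p where "\<forall>z. cmod z = 1 \<longrightarrow> g z = Re (poly p z)"
    using real_polynomial_function_circle[OF g(1)] by blast
  then show ?thesis using g(2) that[of p] by simp
qed

text \<open>Taylor sums of the exponential converge uniformly on a disc containing the image of the
  closed unit disc under \<open>p\<close>, and composing them with \<open>p\<close> gives
  polynomials. The whole disc is covered because the value at \<open>0\<close> matters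
  later.\<close>

lemma exp_poly_approx:
  fixes p :: "complex poly"
  assumes "e > 0"
  obtains q where "\<And>z. cmod z \<le> 1 \<Longrightarrow> cmod (poly q z - exp (poly p z)) < e"
proof -
  have "compact (poly p ` cball 0 1)"
    by (intro compact_continuous_image continuous_intros) auto
  then obtain R where R: "\<And>z. z \<in> cball 0 1 \<Longrightarrow> cmod (poly p z) \<le> R"
    using compact_imp_bounded bounded_iff by (metis imageI)
  have "uniform_limit (cball 0 R) (\<lambda>n w::complex. \<Sum>k<n. w ^ k /\<^sub>R fact k)
      (\<lambda>w. \<Sum>k. w ^ k /\<^sub>R fact k) sequentially"
  proof (rule Weierstrass_m_test)
    show "summable (\<lambda>k. R ^ k /\<^sub>R fact k)" by (rule summable_exp_generic)
    show "norm (w ^ k /\<^sub>R fact k) \<le> R ^ k /\<^sub>R fact k" if "w \<in> cball 0 R" for k and w :: complex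
      using that by (simp add: norm_power power_mono)
  qed
  then have "\<forall>\<^sub>F n in sequentially. \<forall>w\<in>cball 0 R. dist (\<Sum>k<n. w ^ k /\<^sub>R fact k) (exp w :: complex) < e"
    using assms unfolding uniform_limit_iff exp_def by blast
  then obtain n where n: "\<And>w::complex. w \<in> cball 0 R \<Longrightarrow> dist (\<Sum>k<n. w ^ k /\<^sub>R fact k) (exp w) < e"
    unfolding eventually_sequentially by blast
  let ?q = "\<Sum>k<n. smult (inverse (fact k)) (p ^ k)"
  have "cmod (poly ?q z - exp (poly p z)) < e" if "cmod z \<le> 1" for z
    using n[of "poly p z"] R[of z] that
    by (simp add: poly_sum dist_norm scaleR_conv_of_real)
  then show ?thesis using that by blast
qed

section \<open>Polynomials with all zeros on the unit circle\<close>

text \<open>Only the endpoints of \<open>Lam\<close> share a point of the circle, so it suffices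
  that one of the two arguments is interior.\<close>

lemma cis_eq_interior:
  assumes "x \<in> {-pi<..<pi}" "y \<in> Lam" "cis (-x) = cis (-y)"
  shows "x = y"
proof -
  have "-x = Arg (cis (-x))" using assms(1) by (subst Arg_cis) auto
  also have "\<dots> = Arg (cis (-y))" by (simp only: assms(3))
  finally have x: "-x = Arg (cis (-y))" .
  show ?thesis
  proof (cases "y = pi")
    case True
    \<comment> \<open>\<open>Arg\<close> takes values in \<open>(-pi, pi]\<close>, so the angle
      \<open>-pi\<close> has to be replaced by \<open>pi\<close>.\<close>
    then have "cis (-y) = cis pi" by (simp add: complex_eq_iff)
    then have "-x = pi" using x by (simp only: Arg_cis[of pi]) (subst Arg_cis, auto)
    then show ?thesis using assms(1) by simp
  next
    case False
    then have "Arg (cis (-y)) = -y" using assms(2) by (intro Arg_cis) (auto simp: Lam_def)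
    then show ?thesis using x by simp
  qed
qed

lemma AE_cis_neq: "AE x in LM. cis (-x) \<noteq> \<zeta>"
proof -
  have "finite {x \<in> Lam. cis (-x) = \<zeta>}"
  proof -
    have "inj_on (\<lambda>x. cis (-x)) {-pi<..<pi}"
      by (rule inj_onI, rule cis_eq_interior) (auto simp: Lam_def)
    then have "finite ((\<lambda>x. cis (-x)) -` {\<zeta>} \<inter> {-pi<..<pi})"
      by (intro finite_vimage_IntI) auto
    then have "finite (insert (-pi) (insert pi ((\<lambda>x. cis (-x)) -` {\<zeta>} \<inter> {-pi<..<pi})))"
      by simp
    then show ?thesis
      by (rule finite_subset[rotated]) (auto simp: Lam_def)
  qed
  then have "negligible {x \<in> Lam. cis (-x) = \<zeta>}" by (rule negligible_finite)
  then have "{x \<in> Lam. cis (-x) = \<zeta>} \<in> null_sets lebesgue" by (simp add: negligible_iff_null_sets)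
  then show ?thesis
    unfolding AE_LM_iff by (intro AE_I'[of "{x \<in> Lam. cis (-x) = \<zeta>}"]) auto
qed

text \<open>The integrand is the real part of a power series in \<open>cis (-x)\<close> without
  constant term. Its partial sums have mean \<open>0\<close> and are dominated by the geometric
  series of \<open>r\<close>.\<close>

lemma ln_cmod_series_integral:
  assumes r: "0 \<le> r" "r < 1" and \<zeta>: "cmod \<zeta> = 1"
  shows "integral\<^sup>L LM (\<lambda>x. ln (cmod (1 - of_real r * \<zeta> * cis (-x)))) = 0"
    and "integrable LM (\<lambda>x. ln (cmod (1 - of_real r * \<zeta> * cis (-x))))"
proof -
  let ?w = "\<lambda>x. of_real r * \<zeta> * cis (-x)"
  have w: "cmod (?w x) = r" for x using r \<zeta> by (simp add: norm_mult)
  have nz: "1 - ?w x \<noteq> 0" for x using w[of x] r by (metis eq_iff_diff_eq_0 norm_one less_irrefl)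
  show int: "integrable LM (\<lambda>x. ln (cmod (1 - ?w x)))"
    using nz by (intro continuous_integrable_LM continuous_intros) auto
  \<comment> \<open>The term \<open>k = 0\<close> is a division by zero, hence \<open>0\<close>; the
    sum effectively starts at \<open>k = 1\<close>.\<close>
  define s where "s n x = Re (\<Sum>k<n. - (?w x ^ k) / of_nat k)" for n x
  have s0: "integral\<^sup>L LM (s n) = 0" for n
  proof -
    let ?p = "\<Sum>k<n. monom (- ((of_real r * \<zeta>) ^ k) / of_nat k) k"
    have "s n = (\<lambda>x. Re (poly ?p (cis (-x))))"
      by (auto simp: s_def poly_sum poly_monom fun_eq_iff power_mult_distrib)
    moreover have "poly ?p 0 = 0"
      by (auto simp: poly_sum poly_monom power_0_left intro!: sum.neutral)
    ultimately show ?thesis using integral_Re_poly_cis[of ?p] by simp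
  qed
  have "(\<lambda>n. integral\<^sup>L LM (s n)) \<longlonglongrightarrow> integral\<^sup>L LM (\<lambda>x. ln (cmod (1 - ?w x)))"
  proof (rule integral_dominated_convergence[where w = "\<lambda>_. 1 / (1 - r)"])
    show "AE x in LM. (\<lambda>n. s n x) \<longlonglongrightarrow> ln (cmod (1 - ?w x))"
    proof (rule AE_I2)
      fix x
      have "(\<lambda>k. - ((- (- ?w x)) ^ k) / of_nat k) sums ln (1 + (- ?w x))"
        by (rule Ln_series') (use w[of x] r in simp)
      then have "(\<lambda>n. \<Sum>k<n. - (?w x ^ k) / of_nat k) \<longlonglongrightarrow> ln (1 - ?w x)"
        by (simp add: sums_def)
      then have "(\<lambda>n. s n x) \<longlonglongrightarrow> Re (ln (1 - ?w x))"
        unfolding s_def by (rule tendsto_Re)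
      then show "(\<lambda>n. s n x) \<longlonglongrightarrow> ln (cmod (1 - ?w x))"
        by (simp only: Re_Ln[OF nz])
    qed
    show "AE x in LM. norm (s n x) \<le> 1 / (1 - r)" for n
    proof (rule AE_I2)
      fix x
      have "norm (s n x) \<le> cmod (\<Sum>k<n. - (?w x ^ k) / of_nat k)"
        unfolding s_def real_norm_def by (rule abs_Re_le_cmod)
      also have "\<dots> \<le> (\<Sum>k<n. r ^ k)"
      proof (rule sum_norm_le)
        fix k show "cmod (- (?w x ^ k) / of_nat k) \<le> r ^ k"
        proof (cases "k = 0")
          case False
          then have "r ^ k / real k \<le> r ^ k / 1" using r by (intro divide_left_mono) auto
          then show ?thesis by (simp only: norm_divide norm_minus_cancel norm_power w norm_of_nat)
        qed (use r in simp)
      qed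
      also have "\<dots> \<le> (\<Sum>k. r ^ k)"
        using r by (intro sum_le_suminf summable_geometric) auto
      also have "\<dots> = 1 / (1 - r)" using r by (simp add: suminf_geometric)
      finally show "norm (s n x) \<le> 1 / (1 - r)" .
    qed
    show "s n \<in> borel_measurable LM" for n
      unfolding s_def divide_inverse by (intro continuous_measurable_LM continuous_intros)
  qed (use int in auto)
  then show "integral\<^sup>L LM (\<lambda>x. ln (cmod (1 - ?w x))) = 0"
    by (simp add: s0 LIMSEQ_const_iff)
qed

lemma cmod_one_minus_scaled:
  assumes "cmod w = 1" 
  shows "(cmod (1 - of_real r * w))\<^sup>2 = (1 + r)\<^sup>2 - 2 * r * (1 + Re w)"
proof -
  have "(Re w)\<^sup>2 + (Im w)\<^sup>2 = 1" using assms by (simp add: cmod_def)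
  then have "(1 - r * Re w)\<^sup>2 + (r * Im w)\<^sup>2 = (1 + r)\<^sup>2 - 2 * r * (1 + Re w)"
    by algebra
  then show ?thesis by (simp add: cmod_power2)
qed

text \<open>The square of the quotient is \<open>1 - 2 * (1 + Re w) * (r / (1 + r)\<^sup>2)\<close>,
  where \<open>1 + Re w \<ge> 0\<close> and \<open>r / (1 + r)\<^sup>2\<close> increases on
  \<open>[0, 1]\<close>. Without the denominator \<open>1 + r\<close> there is no monotonicity: for
  \<open>w = -1\<close> the modulus grows with \<open>r\<close>.\<close>

lemma cmod_one_minus_scaled_decreasing:
  assumes "cmod w = 1" "0 \<le> r" "r \<le> s" "s \<le> 1"
  shows "cmod (1 - of_real s * w) / (1 + s) \<le> cmod (1 - of_real r * w) / (1 + r)"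
proof (rule power2_le_imp_le)
  have "r * (1 + s)\<^sup>2 \<le> s * (1 + r)\<^sup>2"
  proof -
    have "s * (1 + r)\<^sup>2 - r * (1 + s)\<^sup>2 = (s - r) * (1 - r * s)" by algebra
    moreover have "r * s \<le> 1" using assms by (simp add: mult_le_one)
    ultimately show ?thesis using assms by (smt (verit) mult_nonneg_nonneg)
  qed
  then have "r / (1 + r)\<^sup>2 \<le> s / (1 + s)\<^sup>2" using assms by (simp add: field_simps)
  moreover have "1 + Re w \<ge> 0" using assms(1) abs_Re_le_cmod[of w] by auto
  ultimately have m: "2 * (1 + Re w) * (r / (1 + r)\<^sup>2) \<le> 2 * (1 + Re w) * (s / (1 + s)\<^sup>2)"
    by (intro mult_left_mono) auto
  have e: "(cmod (1 - of_real t * w) / (1 + t))\<^sup>2 = 1 - 2 * (1 + Re w) * (t / (1 + t)\<^sup>2)" if "t \<ge> 0" for t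
    using that by (simp add: power_divide cmod_one_minus_scaled[OF assms(1)] diff_divide_distrib)
  show "(cmod (1 - of_real s * w) / (1 + s))\<^sup>2 \<le> (cmod (1 - of_real r * w) / (1 + r))\<^sup>2"
    using m assms by (simp add: e)
qed (use assms in auto)

lemma cmod_diff_unit:
  assumes "cmod \<zeta> = 1"
  shows "cmod (z - \<zeta>) = cmod (1 - cnj \<zeta> * z)"
proof -
  have "cnj \<zeta> * \<zeta> = 1"
    using assms by (metis complex_norm_square mult.commute of_real_1 power_one)
  then have "1 - cnj \<zeta> * z = - cnj \<zeta> * (z - \<zeta>)" by (simp add: algebra_simps)
  then show ?thesis using assms by (simp add: norm_mult)
qed

text \<open>Monotone convergence as \<open>r\<close> increases to \<open>1\<close>: the quotient \<open>|1 - r w| / (1 + r)\<close> decreases in \<open>r\<close>.\<close>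

lemma integral_ln_cmod_unit_root:
  assumes "cmod \<zeta> = 1"
  shows "integrable LM (\<lambda>x. ln (cmod (cis (-x) - \<zeta>)))"
    and "integral\<^sup>L LM (\<lambda>x. ln (cmod (cis (-x) - \<zeta>))) = 0"
proof -
  define r where "r n = 1 - inverse (real (Suc n))" for n
  have r: "0 \<le> r n" "r n < 1" for n by (auto simp: r_def inverse_le_1_iff)
  have r_lim: "r \<longlonglongrightarrow> 1"
    unfolding r_def using LIMSEQ_inverse_real_of_nat_add_minus[of 1] by simp
  have r_mono: "r m \<le> r n" if "m \<le> n" for m n
    using that by (auto simp: r_def le_imp_inverse_le)
  let ?w = "\<lambda>x. cnj \<zeta> * cis (-x)"
  have w: "cmod (?w x) = 1" for x using assms by (simp add: norm_mult)
  \<comment> \<open>The summand \<open>ln (1 + r n)\<close> makes the sequence increasing at every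
    point and is all that contributes to the integral. At points with
    \<open>cis (-x) = \<zeta>\<close> the sequence is unbounded, so convergence holds almost
    everywhere only.\<close>
  define v where "v n x = - ln (cmod (1 - of_real (r n) * ?w x)) + ln (1 + r n)" for n x
  have nz: "cmod (1 - of_real (r n) * ?w x) > 0" for n x
  proof -
    have "cmod (of_real (r n) * ?w x) = r n" using r[of n] assms by (simp add: norm_mult)
    then show ?thesis using r[of n] by (metis eq_iff_diff_eq_0 norm_one less_irrefl zero_less_norm_iff)
  qed
  have v_eq: "v n x = - ln (cmod (1 - of_real (r n) * ?w x) / (1 + r n))" for n x
    using nz[of n x] r[of n] by (simp add: v_def ln_div)
  have base: "integral\<^sup>L LM (\<lambda>x. ln (cmod (1 - of_real (r n) * ?w x))) = 0"
    "integrable LM (\<lambda>x. ln (cmod (1 - of_real (r n) * ?w x)))" for n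
    using ln_cmod_series_integral[of "r n" "cnj \<zeta>"] r[of n] assms by (simp_all add: mult.assoc)
  have v_int: "integrable LM (v n)" "integral\<^sup>L LM (v n) = 2 * pi * ln (1 + r n)" for n
    unfolding v_def using base[of n] by (simp_all add: measure_LM)
  let ?l = "\<lambda>x. - ln (cmod (cis (-x) - \<zeta>)) + ln 2"
  have lim: "AE x in LM. (\<lambda>n. v n x) \<longlonglongrightarrow> ?l x"
    using AE_cis_neq[of \<zeta>]
  proof eventually_elim
    case (elim x)
    then have nz1: "cmod (1 - ?w x) \<noteq> 0" by (simp flip: cmod_diff_unit[OF assms])
    have "(\<lambda>n. v n x) \<longlonglongrightarrow> - ln (cmod (1 - of_real 1 * ?w x)) + ln (1 + 1)"
      unfolding v_def using nz1 by (intro tendsto_intros r_lim) auto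
    then show ?case by (simp add: cmod_diff_unit[OF assms])
  qed
  have mono: "AE x in LM. mono (\<lambda>n. v n x)"
  proof (rule AE_I2, rule monoI)
    fix x and m n :: nat assume "m \<le> n"
    have "cmod (1 - of_real (r n) * ?w x) / (1 + r n) \<le> cmod (1 - of_real (r m) * ?w x) / (1 + r m)"
      by (rule cmod_one_minus_scaled_decreasing[OF w])
        (use r[of m] r[of n] r_mono[OF \<open>m \<le> n\<close>] in auto)
    moreover have "cmod (1 - of_real (r n) * ?w x) / (1 + r n) > 0"
      using nz[of n x] r[of n] by (intro divide_pos_pos) auto
    ultimately show "v m x \<le> v n x" unfolding v_eq by (simp del: of_real_mult)
  qed
  have ilim: "(\<lambda>n. integral\<^sup>L LM (v n)) \<longlonglongrightarrow> 2 * pi * ln (1 + 1)"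
    unfolding v_int by (intro tendsto_intros r_lim) auto
  have meas: "?l \<in> borel_measurable LM"
  proof -
    have "(\<lambda>x. cmod (cis (-x) - \<zeta>)) \<in> borel_measurable LM"
      by (intro continuous_measurable_LM continuous_intros)
    then show ?thesis by measurable
  qed
  have I: "integrable LM ?l" "integral\<^sup>L LM ?l = 2 * pi * ln (1 + 1)"
    using integrable_monotone_convergence[OF v_int(1) mono lim ilim meas]
      integral_monotone_convergence[OF v_int(1) mono lim ilim meas] by auto
  have "integrable LM (\<lambda>x. ln 2 - ?l x)"
    by (rule Bochner_Integration.integrable_diff[OF _ I(1)]) simp
  then show "integrable LM (\<lambda>x. ln (cmod (cis (-x) - \<zeta>)))" by simp
  have "integral\<^sup>L LM (\<lambda>x. ln 2 - ?l x) = integral\<^sup>L LM (\<lambda>x. ln 2) - integral\<^sup>L LM ?l"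
    by (rule Bochner_Integration.integral_diff[OF _ I(1)]) simp
  then show "integral\<^sup>L LM (\<lambda>x. ln (cmod (cis (-x) - \<zeta>))) = 0"
    unfolding I(2) by (simp add: measure_LM)
qed

text \<open>The polynomial \<open>a\<close> is a partial sum of the geometric series of
  \<open>1 / (1 - r * w)\<close> with \<open>w = cnj \<zeta> * z\<close>. Replacing
  \<open>1 - w\<close> by \<open>1 - r * w\<close> costs a factor \<open>2 / (1 + r)\<close>, and
  truncation costs \<open>1 + r ^ N\<close>; first \<open>r\<close> is taken close to
  \<open>1\<close>, then \<open>N\<close> large.\<close>

lemma unit_root_approx_inverse:
  assumes "cmod \<zeta> = 1" "e > 0"
  obtains a where "poly a 0 = 1" "\<And>z. cmod z = 1 \<Longrightarrow> cmod (poly a z * (z - \<zeta>)) \<le> 1 + e"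
proof -
  have "((\<lambda>r::real. 2 / (1 + r)) \<longlongrightarrow> 2 / (1 + 1)) (at_left 1)"
    by (intro tendsto_intros) auto
  then have "\<forall>\<^sub>F r in at_left (1::real). 2 / (1 + r) < 1 + e / 2"
    using assms by (intro order_tendstoD) auto
  moreover have "\<forall>\<^sub>F r in at_left (1::real). r \<in> {0<..<1}"
    by (intro eventually_at_leftI[of 0]) auto
  ultimately have "\<forall>\<^sub>F r in at_left (1::real). 2 / (1 + r) < 1 + e / 2 \<and> 0 < r \<and> r < 1"
    by eventually_elim auto
  then obtain r :: real where r: "2 / (1 + r) < 1 + e / 2" "0 < r" "r < 1"
    using eventually_happens'[OF trivial_limit_at_left_real] by blast
  have "(\<lambda>N. (1 + e / 2) * (1 + r ^ N)) \<longlonglongrightarrow> (1 + e / 2) * (1 + 0)"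
    using r by (intro tendsto_intros LIMSEQ_realpow_zero) auto
  then have "\<forall>\<^sub>F N in sequentially. (1 + e / 2) * (1 + r ^ N) < 1 + e"
    using assms by (intro order_tendstoD) auto
  \<comment> \<open>An empty sum would vanish at \<open>0\<close>; \<open>N > 0\<close> secures
    \<open>poly a 0 = 1\<close>.\<close>
  then have "\<forall>\<^sub>F N in sequentially. N > 0 \<and> (1 + e / 2) * (1 + r ^ N) < 1 + e"
    using eventually_gt_at_top[of 0] by eventually_elim auto
  then obtain N where N: "N > 0" "(1 + e / 2) * (1 + r ^ N) < 1 + e"
    using eventually_happens'[OF sequentially_bot] by blast
  define a where "a = (\<Sum>k<N. monom ((of_real r * cnj \<zeta>) ^ k) k)"
  have az: "poly a z = (\<Sum>k<N. (of_real r * cnj \<zeta> * z) ^ k)" for z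
    by (simp add: a_def poly_sum poly_monom power_mult_distrib)
  have "poly a 0 = 1"
    using N(1) by (cases N) (simp_all add: az lessThan_Suc_eq_insert_0 zero_notin_Suc_image sum.reindex)
  moreover have "cmod (poly a z * (z - \<zeta>)) \<le> 1 + e" if z: "cmod z = 1" for z
  proof -
    define w where "w = cnj \<zeta> * z"
    have w: "cmod w = 1" using z assms by (simp add: w_def norm_mult)
    have rw: "cmod (of_real r * w) = r" using w r by (simp add: norm_mult)
    have "poly a z * (1 - of_real r * w) = 1 - (of_real r * w) ^ N"
      by (simp add: az w_def mult.assoc one_diff_power_eq mult.commute[of "sum _ _"])
    then have g: "cmod (poly a z) * cmod (1 - of_real r * w) = cmod (1 - (of_real r * w) ^ N)"
      using arg_cong[of _ _ cmod] by (simp only: flip: norm_mult)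
    have "cmod (1 - of_real 1 * w) / (1 + 1) \<le> cmod (1 - of_real r * w) / (1 + r)"
      by (rule cmod_one_minus_scaled_decreasing[OF w]) (use r in auto)
    then have "cmod (1 - w) \<le> 2 / (1 + r) * cmod (1 - of_real r * w)"
      using r by (simp add: field_simps)
    also have "\<dots> \<le> (1 + e / 2) * cmod (1 - of_real r * w)"
      using r by (intro mult_right_mono) auto
    finally have "cmod (poly a z) * cmod (1 - w) \<le> (1 + e / 2) * (cmod (poly a z) * cmod (1 - of_real r * w))"
      using mult_left_mono[of _ _ "cmod (poly a z)"] by (simp only: mult.left_commute norm_ge_zero)
    also have "\<dots> \<le> (1 + e / 2) * (1 + r ^ N)"
    proof (rule mult_left_mono)
      have "cmod (1 - (of_real r * w) ^ N) \<le> 1 + cmod ((of_real r * w) ^ N)"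
        using norm_triangle_ineq4[of 1 "(of_real r * w) ^ N"] by simp
      then show "cmod (poly a z) * cmod (1 - of_real r * w) \<le> 1 + r ^ N"
        unfolding g norm_power rw .
    qed (use assms in simp)
    also have "\<dots> \<le> 1 + e" using N by simp
    finally show ?thesis by (simp add: norm_mult cmod_diff_unit[OF assms(1)] w_def)
  qed
  ultimately show ?thesis using that by blast
qed

text \<open>The list records multiplicities and allows induction factor by factor. Taking each
  factor monic makes both the mean of \<open>ln\<close> of the modulus and its value at
  \<open>0\<close> equal to \<open>0\<close>.\<close>

definition unit_roots :: "complex poly \<Rightarrow> bool" where
  "unit_roots A \<longleftrightarrow> (\<exists>zs. A = (\<Prod>\<zeta>\<leftarrow>zs. [:-\<zeta>, 1:]) \<and> (\<forall>\<zeta>\<in>set zs. cmod \<zeta> = 1))"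

lemma poly_root_mult: "poly ([:-\<zeta>, 1:] * A) z = (z - \<zeta>) * poly A z"
  for \<zeta> :: complex
  by (simp add: algebra_simps)

lemma unit_roots_induct [consumes 1, case_names one mult]:
  assumes "unit_roots A" "P 1"
    and "\<And>\<zeta> A. cmod \<zeta> = 1 \<Longrightarrow> unit_roots A \<Longrightarrow> P A \<Longrightarrow> P ([:-\<zeta>, 1:] * A)"
  shows "P A"
proof -
  have "\<forall>\<zeta>\<in>set zs. cmod \<zeta> = 1 \<Longrightarrow> P (\<Prod>\<zeta>\<leftarrow>zs. [:-\<zeta>, 1:])" for zs
  proof (induction zs)
    case Nil
    show ?case using assms(2) by simp
  next
    case (Cons \<zeta> zs)
    then show ?case using assms(3)[of \<zeta>] by (auto simp: unit_roots_def)
  qed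
  then show ?thesis using assms(1) by (auto simp: unit_roots_def)
qed

lemma unit_roots_1: "unit_roots 1"
  by (auto simp: unit_roots_def intro!: exI[of _ "[]"])

lemma unit_roots_mult:
  assumes "cmod \<zeta> = 1" "unit_roots A"
  shows "unit_roots ([:-\<zeta>, 1:] * A)"
proof -
  obtain zs where "A = (\<Prod>\<zeta>\<leftarrow>zs. [:-\<zeta>, 1:])" "\<forall>\<zeta>\<in>set zs. cmod \<zeta> = 1"
    using assms(2) by (auto simp: unit_roots_def)
  then show ?thesis
    using assms(1) unfolding unit_roots_def by (intro exI[of _ "\<zeta> # zs"]) simp
qed

lemma unit_roots_AE_nonzero:
  assumes "unit_roots A"
  shows "AE x in LM. poly A (cis (-x)) \<noteq> 0"
  using assms
proof (induction rule: unit_roots_induct)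
  case (mult \<zeta> A)
  show ?case using mult.IH AE_cis_neq[of \<zeta>] by eventually_elim auto
qed simp

text \<open>The means of the factors add up; the logarithm of the product splits off the finitely
  many zeros.\<close>

lemma unit_roots_integral_ln:
  assumes "unit_roots A"
  shows "integrable LM (\<lambda>x. ln ((cmod (poly A (cis (-x))))\<^sup>2)) \<and>
         integral\<^sup>L LM (\<lambda>x. ln ((cmod (poly A (cis (-x))))\<^sup>2)) = 0"
  using assms
proof (induction rule: unit_roots_induct)
  case one
  show ?case by simp
next
  case (mult \<zeta> A)
  let ?u = "\<lambda>x. ln (cmod (cis (-x) - \<zeta>))"
  let ?v = "\<lambda>x. ln ((cmod (poly A (cis (-x))))\<^sup>2)"
  let ?l = "\<lambda>x. ln ((cmod (poly ([:-\<zeta>, 1:] * A) (cis (-x))))\<^sup>2)"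
  note u = integral_ln_cmod_unit_root[OF mult(1)]
  have ae: "AE x in LM. 2 * ?u x + ?v x = ?l x"
    using AE_cis_neq[of \<zeta>] unit_roots_AE_nonzero[OF mult(2)]
    by eventually_elim (simp add: poly_root_mult norm_mult power_mult_distrib ln_mult ln_realpow del: poly_mult mult_pCons_left)
  have int: "integrable LM (\<lambda>x. 2 * ?u x + ?v x)"
    using u(1) mult.IH by (intro Bochner_Integration.integrable_add integrable_mult_right) auto
  have "integral\<^sup>L LM (\<lambda>x. 2 * ?u x + ?v x) = 2 * integral\<^sup>L LM ?u + integral\<^sup>L LM ?v"
    using u(1) mult.IH by (subst Bochner_Integration.integral_add) auto
  then have "integral\<^sup>L LM (\<lambda>x. 2 * ?u x + ?v x) = 0"
    using u(2) mult.IH by simp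
  then show ?case using integrable_LM_AE[OF int ae] by simp
qed

lemma unit_roots_cmod_0: "unit_roots A \<Longrightarrow> cmod (poly A 0) = 1"
  by (induction rule: unit_roots_induct) (simp, simp only: poly_root_mult norm_mult, simp)

lemma unit_roots_approx_inverse:
  assumes "unit_roots A" "e > 0"
  shows "\<exists>a. poly a 0 = 1 \<and> (\<forall>z. cmod z = 1 \<longrightarrow> cmod (poly a z * poly A z) \<le> 1 + e)"
  using assms
proof (induction arbitrary: e rule: unit_roots_induct)
  case one
  then show ?case by (intro exI[of _ 1]) auto
next
  case (mult \<zeta> A)
  \<comment> \<open>Each of the two factors receives the bound \<open>sqrt (1 + e)\<close>, so that
    the product is bounded by \<open>1 + e\<close>.\<close>
  have s: "sqrt (1 + e) - 1 > 0" using mult.prems by simp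
  obtain a where a: "poly a 0 = 1" "\<And>z. cmod z = 1 \<Longrightarrow> cmod (poly a z * poly A z) \<le> sqrt (1 + e)"
    using mult.IH[OF s] by auto
  obtain b where b: "poly b 0 = 1" "\<And>z. cmod z = 1 \<Longrightarrow> cmod (poly b z * (z - \<zeta>)) \<le> sqrt (1 + e)"
    using unit_root_approx_inverse[OF mult(1) s] by auto
  have "cmod (poly (a * b) z * poly ([:-\<zeta>, 1:] * A) z) \<le> 1 + e" if z: "cmod z = 1" for z
  proof -
    have "cmod (poly (a * b) z * poly ([:-\<zeta>, 1:] * A) z) =
        cmod (poly a z * poly A z) * cmod (poly b z * (z - \<zeta>))"
      unfolding poly_root_mult by (simp add: norm_mult)
    also have "\<dots> \<le> sqrt (1 + e) * sqrt (1 + e)"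
      by (rule mult_mono[OF a(2)[OF z] b(2)[OF z]]) (use mult.prems in simp_all)
    also have "\<dots> = 1 + e" using mult.prems by simp
    finally show ?thesis .
  qed
  moreover have "poly (a * b) 0 = 1" using a(1) b(1) by simp
  ultimately show ?case by blast
qed

section \<open>Nonnegative trigonometric polynomials\<close>

text \<open>Along the circle the quotient is a real function of the angle with a minimum
  \<open>0\<close> at \<open>\<zeta>\<close>. Its angular derivative \<open>D\<close> therefore
  vanishes, and \<open>D\<close> is a nonzero multiple of the derivative of
  \<open>P\<close>.\<close>

lemma nonneg_circle_double_root:
  fixes P :: "complex poly"
  assumes nonneg: "\<And>z. cmod z = 1 \<Longrightarrow> Im (poly P z / z ^ \<nu>) = 0 \<and> Re (poly P z / z ^ \<nu>) \<ge> 0"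
    and \<zeta>: "cmod \<zeta> = 1" "poly P \<zeta> = 0"
  shows "poly (pderiv P) \<zeta> = 0"
proof -
  have nz: "\<zeta> \<noteq> 0" using \<zeta>(1) by auto
  let ?\<phi> = "\<lambda>z. poly P z / z ^ \<nu>"
  define D where "D = poly (pderiv P) \<zeta> / \<zeta> ^ \<nu> * (\<i> * \<zeta>)"
  let ?F = "\<lambda>\<theta>. ?\<phi> (\<zeta> * cis \<theta>)"
  \<comment> \<open>The other term of the quotient rule contains
    \<open>poly P \<zeta> = 0\<close>.\<close>
  have "(?\<phi> has_field_derivative poly (pderiv P) \<zeta> / \<zeta> ^ \<nu>) (at \<zeta>)"
    using nz \<zeta>(2) by (auto intro!: derivative_eq_intros poly_DERIV)
  then have \<phi>: "(?\<phi> has_field_derivative poly (pderiv P) \<zeta> / \<zeta> ^ \<nu>) (at (\<zeta> * cis 0))"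
    by simp
  have "((\<lambda>\<theta>. \<zeta> * cis \<theta>) has_vector_derivative \<i> * \<zeta>) (at 0)"
    unfolding cis_conv_exp
    by (rule has_vector_derivative_real_field[where f = "\<lambda>w. \<zeta> * exp (\<i> * w)"])
      (auto intro!: derivative_eq_intros simp: mult_ac)
  from field_vector_diff_chain_at[OF this \<phi>]
  have F: "(?F has_vector_derivative D) (at 0)"
    by (simp add: o_def D_def mult_ac)
  have real: "Im (?F \<theta>) = 0" "Re (?F \<theta>) \<ge> 0" for \<theta>
    using nonneg[of "\<zeta> * cis \<theta>"] \<zeta>(1) by (auto simp: norm_mult)
  have "((\<lambda>\<theta>. Im (?F \<theta>)) has_vector_derivative Im D) (at 0)"
    using bounded_linear.has_vector_derivative[OF bounded_linear_Im F] by simp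
  then have "Im D = 0"
    unfolding real using vector_derivative_unique_at has_vector_derivative_const by blast
  moreover have "((\<lambda>\<theta>. Re (?F \<theta>)) has_vector_derivative Re D) (at 0)"
    using bounded_linear.has_vector_derivative[OF bounded_linear_Re F] by simp
  then have "((\<lambda>\<theta>. Re (?F \<theta>)) has_real_derivative Re D) (at 0)"
    by (simp add: has_real_derivative_iff_has_vector_derivative)
  then have "Re D = 0"
  proof (rule DERIV_local_min[of _ _ _ 1])
    show "\<forall>y. \<bar>0 - y\<bar> < 1 \<longrightarrow> Re (?F 0) \<le> Re (?F y)"
    proof (intro allI impI)
      fix y :: real
      have "Re (?F 0) = 0" using \<zeta>(2) by simp
      then show "Re (?F 0) \<le> Re (?F y)" using real(2)[of y] by linarith
    qed
  qed simp
  ultimately have "D = 0" by (simp add: complex_eq_iff)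
  then show ?thesis using nz by (simp add: D_def)
qed

text \<open>On the circle conjugation is inversion, so \<open>|z - \<zeta>|\<^sup>2 = (z - \<zeta>)
  * (1 / z - 1 / \<zeta>)\<close>. This turns a double root into a nonnegative factor times a
  monomial.\<close>

lemma cmod_power2_diff_unit:
  assumes "cmod z = 1" "cmod \<zeta> = 1"
  shows "(z - \<zeta>) * (z - \<zeta>) = - \<zeta> * z * of_real ((cmod (z - \<zeta>))\<^sup>2)"
proof -
  have "z * cnj z = 1" "\<zeta> * cnj \<zeta> = 1"
    using assms by (metis complex_norm_square of_real_1 power_one)+
  then show ?thesis unfolding complex_norm_square complex_cnj_diff by algebra
qed

text \<open>Only the zeros on the unit circle have to be split off: they have even order, so a factor
  \<open>|z - \<zeta>|\<^sup>2\<close> can be removed as long as there is one.\<close>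

lemma nonneg_circle_factor:
  fixes P :: "complex poly"
  assumes "P \<noteq> 0"
    and "\<And>z. cmod z = 1 \<Longrightarrow> Im (poly P z / z ^ \<nu>) = 0 \<and> Re (poly P z / z ^ \<nu>) \<ge> 0"
  shows "\<exists>A W. unit_roots A \<and> continuous_on (sphere 0 1) W \<and> (\<forall>z. cmod z = 1 \<longrightarrow>
      W z > 0 \<and> Re (poly P z / z ^ \<nu>) = (cmod (poly A z))\<^sup>2 * W z)"
  using assms
proof (induction "degree P" arbitrary: P rule: less_induct)
  case (less P)
  note nonneg = less.prems(2)
  show ?case
  proof (cases "\<exists>\<zeta>. cmod \<zeta> = 1 \<and> poly P \<zeta> = 0")
    case False
    have "continuous_on (sphere 0 1) (\<lambda>z. Re (poly P z / z ^ \<nu>))"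
      by (intro continuous_intros) auto
    moreover have "Re (poly P z / z ^ \<nu>) > 0" if z: "cmod z = 1" for z
    proof -
      have "z \<noteq> 0" using z by auto
      then have "poly P z / z ^ \<nu> \<noteq> 0" using False z by auto
      then show ?thesis using nonneg[OF z] by (auto simp: complex_eq_iff less_le)
    qed
    ultimately show ?thesis
      using unit_roots_1 by (intro exI[of _ 1] exI[of _ "\<lambda>z. Re (poly P z / z ^ \<nu>)"]) simp
  next
    case True
    then obtain \<zeta> where \<zeta>: "cmod \<zeta> = 1" "poly P \<zeta> = 0" by blast
    have nz: "\<zeta> \<noteq> 0" using \<zeta>(1) by auto
    obtain Q where Q: "P = [:-\<zeta>, 1:] * Q"
      using \<zeta>(2) by (auto simp: poly_eq_0_iff_dvd dvd_def)
    have "poly Q \<zeta> = 0"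
      using nonneg_circle_double_root[OF nonneg \<zeta>] unfolding Q pderiv_mult by (simp add: pderiv_pCons)
    then obtain R where R: "Q = [:-\<zeta>, 1:] * R"
      by (auto simp: poly_eq_0_iff_dvd dvd_def)
    have R0: "R \<noteq> 0" using less.prems(1) Q R by auto
    have degP: "degree P = degree R + 2"
      unfolding Q R using R0 by (simp add: degree_mult_eq del: mult_pCons_left)
    \<comment> \<open>The remaining monomial \<open>- \<zeta> * z\<close> is absorbed into the
      cofactor. The exponent \<open>\<nu>\<close> thus stays fixed, and the degree still drops by
      one.\<close>
    define P1 where "P1 = smult (-\<zeta>) (pCons 0 R)"
    have P1: "P1 \<noteq> 0" "degree P1 < degree P"
      using R0 nz by (simp_all add: P1_def degP)
    let ?\<phi> = "\<lambda>z. poly P1 z / z ^ \<nu>"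
    have scale: "Re (of_real r * w) = r * Re w" "Im (of_real r * w) = r * Im w" for r w by simp_all
    have split: "poly P z / z ^ \<nu> = of_real ((cmod (z - \<zeta>))\<^sup>2) * ?\<phi> z" if z: "cmod z = 1" for z
    proof -
      have "poly P z = ((z - \<zeta>) * (z - \<zeta>)) * poly R z"
        by (simp only: Q R poly_root_mult mult.assoc)
      also have "\<dots> = of_real ((cmod (z - \<zeta>))\<^sup>2) * poly P1 z"
        unfolding cmod_power2_diff_unit[OF z \<zeta>(1)] by (simp add: P1_def algebra_simps)
      finally show ?thesis by simp
    qed
    have ne: "Im (?\<phi> z) = 0 \<and> Re (?\<phi> z) \<ge> 0" if z: "cmod z = 1" "z \<noteq> \<zeta>" for z
    proof -
      have "(cmod (z - \<zeta>))\<^sup>2 > 0" using z(2) by simp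
      then show ?thesis
        using nonneg[OF z(1)] unfolding split[OF z(1)] scale
        by (auto simp: zero_le_mult_iff)
    qed
    \<comment> \<open>At \<open>\<zeta>\<close> itself the factor
      \<open>|z - \<zeta>|\<^sup>2\<close> cannot be divided out; the sign is obtained as a limit
      along other points of the circle.\<close>
    have at: "Im (?\<phi> \<zeta>) = 0 \<and> Re (?\<phi> \<zeta>) \<ge> 0"
    proof -
      define w where "w n = \<zeta> * cis (inverse (real (Suc n)))" for n
      have "w n \<noteq> \<zeta>" for n
      proof -
        have "inverse (real (Suc n)) < pi" using pi_gt3 inverse_le_1_iff[of "real (Suc n)"] by linarith
        then have "sin (inverse (real (Suc n))) > 0" by (intro sin_gt_zero) auto
        then have "cis (inverse (real (Suc n))) \<noteq> 1" by (auto simp: complex_eq_iff)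
        then show ?thesis using nz by (simp add: w_def)
      qed
      moreover have "cmod (w n) = 1" for n using \<zeta>(1) by (simp add: w_def norm_mult)
      ultimately have w: "Im (?\<phi> (w n)) = 0" "Re (?\<phi> (w n)) \<ge> 0" for n using ne by auto
      have "w \<longlonglongrightarrow> \<zeta> * cis 0"
        unfolding w_def by (intro tendsto_intros tendsto_cis LIMSEQ_inverse_real_of_nat)
      then have "(\<lambda>n. ?\<phi> (w n)) \<longlonglongrightarrow> ?\<phi> \<zeta>"
        using nz by (intro tendsto_intros) auto
      then have "(\<lambda>n. Im (?\<phi> (w n))) \<longlonglongrightarrow> Im (?\<phi> \<zeta>)" "(\<lambda>n. Re (?\<phi> (w n))) \<longlonglongrightarrow> Re (?\<phi> \<zeta>)"
        by (auto intro: tendsto_Im tendsto_Re)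
      then show ?thesis
        unfolding w(1) using w(2) by (auto simp only: LIMSEQ_const_iff intro: LIMSEQ_le_const)
    qed
    obtain A W where AW: "unit_roots A" "continuous_on (sphere 0 1) W"
      "\<And>z. cmod z = 1 \<Longrightarrow> W z > 0 \<and> Re (?\<phi> z) = (cmod (poly A z))\<^sup>2 * W z"
    proof -
      have "Im (?\<phi> z) = 0 \<and> Re (?\<phi> z) \<ge> 0" if "cmod z = 1" for z
        using ne[OF that] at by (cases "z = \<zeta>") simp_all
      then show ?thesis using that less.hyps[OF P1(2,1)] by blast
    qed
    have "Re (poly P z / z ^ \<nu>) = (cmod (poly ([:-\<zeta>, 1:] * A) z))\<^sup>2 * W z" if z: "cmod z = 1" for z
      unfolding split[OF z] poly_root_mult scale
      using AW(3)[OF z] by (simp add: norm_mult power_mult_distrib)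
    then show ?thesis
      using AW unit_roots_mult[OF \<zeta>(1) AW(1)] by blast
  qed
qed

lemma trig_poly_factor:
  assumes t: "trig_poly t" "\<forall>x\<in>Lam. t x \<ge> 0" "\<exists>x\<in>Lam. t x \<noteq> 0"
  obtains A W where "unit_roots A" "continuous_on (sphere 0 1) W" "\<And>z. cmod z = 1 \<Longrightarrow> W z > 0"
    "\<And>x. x \<in> Lam \<Longrightarrow> t x = (cmod (poly A (cis (-x))))\<^sup>2 * W (cis (-x))"
proof -
  obtain \<nu> :: nat and c where c: "\<And>x. x \<in> Lam \<Longrightarrow>
      complex_of_real (t x) = (\<Sum>k\<in>{-int \<nu>..int \<nu>}. c k * exp (\<i> * of_int k * of_real x))"
    using t(1) unfolding trig_poly_def by blast
  \<comment> \<open>Since \<open>exp (\<i> * k * x)\<close> is \<open>z\<close> to the power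
    \<open>-k\<close> for \<open>z = cis (-x)\<close>, multiplication by \<open>z ^ \<nu>\<close>
    clears all negative powers.\<close>
  define P where "P = (\<Sum>k\<in>{-int \<nu>..int \<nu>}. monom (c k) (nat (int \<nu> - k)))"
  have P: "poly P (cis (-x)) / cis (-x) ^ \<nu> = of_real (t x)" if "x \<in> Lam" for x
  proof -
    have "exp (\<i> * of_int k * of_real x) = cis (-x) ^ nat (int \<nu> - k) / cis (-x) ^ \<nu>"
      if k: "k \<in> {-int \<nu>..int \<nu>}" for k
    proof -
      have "real (nat (int \<nu> - k)) = real \<nu> - of_int k" using k by simp
      then have "cis (-x) ^ nat (int \<nu> - k) / cis (-x) ^ \<nu> = cis (of_int k * x)"
        by (simp add: Complex.DeMoivre cis_divide algebra_simps)
      then show ?thesis by (simp add: cis_conv_exp mult_ac)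
    qed
    then show ?thesis
      unfolding c[OF that] P_def poly_sum poly_monom sum_divide_distrib by (intro sum.cong) auto
  qed
  have ex: "\<exists>x\<in>Lam. z = cis (-x)" if "cmod z = 1" for z
  proof
    show "z = cis (- (- Arg z))" using that rcis_cmod_Arg[of z] by (simp add: rcis_def)
    show "- Arg z \<in> Lam" using Arg_bounded[of z] by (auto simp: Lam_def)
  qed
  have "Im (poly P z / z ^ \<nu>) = 0 \<and> Re (poly P z / z ^ \<nu>) \<ge> 0" if z: "cmod z = 1" for z
    using ex[OF z] P t(2) by auto
  moreover have "P \<noteq> 0" using P t(3) by fastforce
  ultimately obtain A W where AW: "unit_roots A" "continuous_on (sphere 0 1) W"
    "\<And>z. cmod z = 1 \<Longrightarrow> W z > 0 \<and> Re (poly P z / z ^ \<nu>) = (cmod (poly A z))\<^sup>2 * W z"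
    using nonneg_circle_factor[of P \<nu>] by blast
  have "t x = (cmod (poly A (cis (-x))))\<^sup>2 * W (cis (-x))" if "x \<in> Lam" for x
    using AW(3)[of "cis (-x)"] P[OF that] by simp
  then show ?thesis using that AW by blast
qed

section \<open>Almost everywhere continuous functions\<close>

text \<open>If no subinterval contained \<open>x\<close>, induction along the nodes would place
  \<open>x\<close> beyond the last one.\<close>

lemma partition_locate:
  fixes xs :: "real list"
  assumes "length xs \<ge> 2" "hd xs \<le> x" "x \<le> last xs"
  obtains i where "i < length xs - 1" "xs ! i \<le> x" "x \<le> xs ! Suc i"
proof (rule ccontr)
  assume "\<not> thesis"
  then have no: "i < length xs - 1 \<Longrightarrow> xs ! i \<le> x \<Longrightarrow> \<not> x \<le> xs ! Suc i" for i
    using that[of i] by blast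
  have "i < length xs - 1 \<Longrightarrow> xs ! i \<le> x" for i
  proof (induction i)
    case 0
    then show ?case using assms by (metis hd_conv_nth list.size(3) not_numeral_le_zero)
  next
    case (Suc i)
    then show ?case using no[of i] by simp
  qed
  then have "\<not> x \<le> xs ! Suc (length xs - 2)"
    using assms(1) by (intro no) auto
  moreover have "Suc (length xs - 2) = length xs - 1" using assms(1) by simp
  moreover have "last xs = xs ! (length xs - 1)" using assms(1) by (intro last_conv_nth) auto
  ultimately show False using assms(3) by simp
qed

lemma abs_diff_le_Sup_minus_Inf:
  fixes h :: "'a \<Rightarrow> real"
  assumes "bounded (h ` S)" "x \<in> S" "y \<in> S"
  shows "\<bar>h y - h x\<bar> \<le> Sup (h ` S) - Inf (h ` S)"
proof -
  have "h u \<le> Sup (h ` S)" "Inf (h ` S) \<le> h u" if "u \<in> S" for u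
    using that assms(1) by (auto intro: cSup_upper cInf_lower bounded_imp_bdd_above bounded_imp_bdd_below)
  from this[OF assms(2)] this[OF assms(3)] show ?thesis by linarith
qed

text \<open>One direction of Lebesgue's criterion. The step function \<open>D n\<close> carries the
  oscillations of \<open>h\<close> on the cells of the \<open>n\<close>-th partition; its integral
  tends to \<open>0\<close>, so the infimum over \<open>n\<close> vanishes almost everywhere. Where
  it vanishes, cells of arbitrarily small oscillation contain \<open>x\<close>.\<close>

lemma riemann_integrable_AE_isCont:
  assumes "riemann_integrable_on h a b"
  shows "AE x in lebesgue. x \<in> {a..b} \<longrightarrow> isCont h x"
proof -
  have bdd: "bounded (h ` {a..b})" using assms by (simp add: riemann_integrable_on_def)
  define osc where "osc xs i = Sup (h ` {xs!i..xs!(Suc i)}) - Inf (h ` {xs!i..xs!(Suc i)})"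
    for xs :: "real list" and i
  have "\<forall>n. \<exists>xs::real list. length xs \<ge> 2 \<and> sorted_wrt (<) xs \<and> hd xs = a \<and> last xs = b \<and>
        (\<Sum>i<length xs - 1. osc xs i * (xs!(Suc i) - xs!i)) < inverse (real (Suc n))"
    using assms unfolding riemann_integrable_on_def osc_def by simp
  from choice[OF this] obtain X :: "nat \<Rightarrow> real list" where X: "\<And>n. length (X n) \<ge> 2" "\<And>n. sorted_wrt (<) (X n)"
    "\<And>n. hd (X n) = a" "\<And>n. last (X n) = b"
    "\<And>n. (\<Sum>i<length (X n) - 1. osc (X n) i * (X n!(Suc i) - X n!i)) < inverse (real (Suc n))"
    by blast
  have le: "X n ! i \<le> X n ! j" if "i \<le> j" "j < length (X n)" for n i j
    using sorted_wrt_nth_less[OF X(2), of i j n] that by (cases "i = j") auto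
  have sub: "{X n!i..X n!(Suc i)} \<subseteq> {a..b}" if "i < length (X n) - 1" for n i
  proof -
    have ne: "X n \<noteq> []" using X(1)[of n] by auto
    have "a = X n ! 0" "b = X n ! (length (X n) - 1)"
      using X(3,4)[of n] ne by (simp_all add: hd_conv_nth last_conv_nth)
    then show ?thesis using le[of 0 i n] le[of "Suc i" "length (X n) - 1" n] that by auto
  qed
  have osc_le: "\<bar>h y - h x\<bar> \<le> osc (X n) i"
    if "i < length (X n) - 1" "x \<in> {X n!i..X n!(Suc i)}" "y \<in> {X n!i..X n!(Suc i)}" for n i x y
    unfolding osc_def
    by (rule abs_diff_le_Sup_minus_Inf[OF bounded_subset[OF bdd]]) (use sub[OF that(1)] that in auto)
  have osc_nonneg: "osc (X n) i \<ge> 0" if "i < length (X n) - 1" for n i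
    using osc_le[OF that, of "X n!i" "X n!i"] le[of i "Suc i" n] that by simp
  define D where "D n x = (\<Sum>i<length (X n) - 1. ennreal (osc (X n) i) * indicator {X n!i..X n!(Suc i)} x)" for n x
  have [measurable]: "D n \<in> borel_measurable lborel" for n unfolding D_def by measurable
  have int_D: "(\<integral>\<^sup>+x. D n x \<partial>lborel) \<le> ennreal (inverse (real (Suc n)))" for n
  proof -
    have "(\<integral>\<^sup>+x. D n x \<partial>lborel) =
        (\<Sum>i<length (X n) - 1. ennreal (osc (X n) i) * emeasure lborel {X n!i..X n!(Suc i)})"
      unfolding D_def by (subst nn_integral_sum) (auto simp: nn_integral_cmult_indicator)
    also have "\<dots> = (\<Sum>i<length (X n) - 1. ennreal (osc (X n) i * (X n!(Suc i) - X n!i)))"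
      using le[of _ "Suc _" n] osc_nonneg by (intro sum.cong) (auto simp: ennreal_mult)
    also have "\<dots> = ennreal (\<Sum>i<length (X n) - 1. osc (X n) i * (X n!(Suc i) - X n!i))"
      using le[of _ "Suc _" n] osc_nonneg by (intro sum_ennreal) (auto intro!: mult_nonneg_nonneg)
    also have "\<dots> \<le> ennreal (inverse (real (Suc n)))"
      using X(5)[of n] by (intro ennreal_leI) simp
    finally show ?thesis .
  qed
  have "(\<integral>\<^sup>+x. (INF n. D n x) \<partial>lborel) = 0"
  proof -
    have "(\<integral>\<^sup>+x. (INF n. D n x) \<partial>lborel) \<le> ennreal (inverse (real (Suc n)))" for n
      by (rule order_trans[OF nn_integral_mono int_D]) (auto intro: INF_lower)
    moreover have "(\<lambda>n. ennreal (inverse (real (Suc n)))) \<longlonglongrightarrow> ennreal 0"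
      by (intro tendsto_ennrealI LIMSEQ_inverse_real_of_nat)
    ultimately have "(\<integral>\<^sup>+x. (INF n. D n x) \<partial>lborel) \<le> ennreal 0"
      by (intro LIMSEQ_le_const) auto
    then show ?thesis by simp
  qed
  then have "AE x in lborel. (INF n. D n x) = 0"
    by (subst (asm) nn_integral_0_iff_AE) auto
  then have ae1: "AE x in lebesgue. (INF n. D n x) = 0"
    by (rule AE_completion)
  \<comment> \<open>Off the nodes, which include \<open>a\<close> and \<open>b\<close>, the cell
    containing \<open>x\<close> is a neighbourhood of \<open>x\<close>; this gives two-sided
    continuity.\<close>
  have "countable (\<Union>n. set (X n))" by (intro countable_UN) (auto intro: countable_finite)
  then have ae2: "AE x in lebesgue. x \<notin> (\<Union>n. set (X n))"
    by (intro AE_not_in null_sets_completionI countable_imp_null_set_lborel)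
  show ?thesis using ae1 ae2
  proof eventually_elim
    case (elim x)
    show ?case
    proof
      assume x: "x \<in> {a..b}"
      have "\<forall>\<^sub>F y in at x. dist (h y) (h x) < e" if e: "e > 0" for e
      proof -
        have "(INF n. D n x) < ennreal e" using elim(1) e by simp
        then obtain n where n: "D n x < ennreal e" by (auto simp: INF_less_iff)
        obtain i where i: "i < length (X n) - 1" "X n ! i \<le> x" "x \<le> X n ! Suc i"
          using partition_locate[OF X(1), of n x] X(3,4)[of n] x by auto
        have "ennreal (osc (X n) i) \<le> D n x"
        proof -
          have "ennreal (osc (X n) i) = ennreal (osc (X n) i) * indicator {X n!i..X n!(Suc i)} x"
            using i by simp
          also have "\<dots> \<le> D n x"
            unfolding D_def using i by (intro member_le_sum) auto
          finally show ?thesis .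
        qed
        then have "osc (X n) i < e"
          using n e osc_nonneg[OF i(1)] by (simp add: order_le_less_trans flip: ennreal_less_iff)
        have "X n ! i \<in> set (X n)" "X n ! Suc i \<in> set (X n)" using i(1) by auto
        then have "x \<noteq> X n ! i" "x \<noteq> X n ! Suc i" using elim(2) by blast+
        then have "x \<in> {X n ! i<..<X n ! Suc i}" using i by auto
        then have "\<forall>\<^sub>F y in nhds x. y \<in> {X n ! i<..<X n ! Suc i}"
          by (intro eventually_nhds_in_open) auto
        then have "\<forall>\<^sub>F y in at x. y \<in> {X n ! i<..<X n ! Suc i}"
          by (rule eventually_at_filter[THEN iffD2, OF eventually_mono]) simp
        then show ?thesis
        proof eventually_elim
          case (elim y)
          then have "\<bar>h y - h x\<bar> \<le> osc (X n) i" using i by (intro osc_le) auto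
          then show ?case using \<open>osc (X n) i < e\<close> by (simp add: dist_real_def)
        qed
      qed
      then show "isCont h x" unfolding isCont_def tendsto_iff by blast
    qed
  qed
qed

text \<open>\<open>U k\<close> is the Lipschitz regularisation of \<open>H\<close>: the infimum of
  \<open>H y\<close> plus a penalty \<open>k\<close> times the chordal distance to
  \<open>cis (-y)\<close>. It is \<open>k\<close>-Lipschitz and lies below \<open>H\<close>; as
  \<open>k\<close> grows, only \<open>y\<close> near \<open>x\<close> can compete, so continuity of
  \<open>H\<close> at \<open>x\<close> gives convergence.\<close>

lemma circle_minorants:
  fixes H :: "real \<Rightarrow> real"
  assumes bdd: "\<forall>x\<in>Lam. \<bar>H x\<bar> \<le> K" and cont: "AE x in LM. isCont H x"
  obtains U :: "nat \<Rightarrow> complex \<Rightarrow> real" where "\<And>k. continuous_on UNIV (U k)"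
    "\<And>k x. x \<in> Lam \<Longrightarrow> U k (cis (-x)) \<le> H x" "\<And>k z. - K \<le> U k z"
    "AE x in LM. (\<lambda>k. U k (cis (-x))) \<longlonglongrightarrow> H x"
proof -
  define V where "V k z y = H y + real k * cmod (z - cis (-y))" for k z y
  define U where "U k z = (INF y\<in>Lam. V k z y)" for k z
  have ne: "Lam \<noteq> {}" by (simp add: Lam_def)
  have V_ge: "- K \<le> V k z y" if "y \<in> Lam" for k z y
  proof -
    have "0 \<le> real k * cmod (z - cis (-y))" by simp
    then show ?thesis unfolding V_def using bdd[rule_format, OF that] by linarith
  qed
  have U_le: "U k z \<le> V k z y" if "y \<in> Lam" for k z y
    unfolding U_def using V_ge that by (intro cINF_lower bdd_belowI[of _ "-K"]) auto
  have U_ge: "c \<le> U k z" if "\<And>y. y \<in> Lam \<Longrightarrow> c \<le> V k z y" for c k z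
    unfolding U_def using ne that by (rule cINF_greatest)
  have U_le_H: "U k (cis (-x)) \<le> H x" if "x \<in> Lam" for k x
    using U_le[OF that, of k "cis (-x)"] by (simp add: V_def)
  have lip: "U k z - real k * cmod (z - w) \<le> U k w" for k z w
  proof (rule U_ge)
    fix y assume y: "y \<in> Lam"
    have "cmod (z - cis (-y)) \<le> cmod (w - cis (-y)) + cmod (z - w)"
      using norm_triangle_ineq[of "w - cis (-y)" "z - w"] by simp
    then have "real k * cmod (z - cis (-y)) \<le> real k * (cmod (w - cis (-y)) + cmod (z - w))"
      by (intro mult_left_mono) auto
    then show "U k z - real k * cmod (z - w) \<le> V k w y"
      using U_le[OF y, of k z] by (simp add: V_def algebra_simps)
  qed
  have "(real k)-lipschitz_on UNIV (U k)" for k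
  proof (rule lipschitz_onI)
    show "dist (U k z) (U k w) \<le> real k * dist z w" for z w
      using lip[of k z w] lip[of k w z] by (simp add: dist_real_def dist_norm norm_minus_commute abs_le_iff)
  qed simp
  then have U_cont: "continuous_on UNIV (U k)" for k
    by (rule lipschitz_on_continuous_on)
  \<comment> \<open>The endpoints are removed because they share a point of the circle, where
    \<open>H\<close> may have two different values.\<close>
  have "AE x in LM. x \<in> {-pi<..<pi}"
  proof -
    have "negligible {-pi, pi}" by (rule negligible_finite) simp
    then have "{-pi, pi} \<in> null_sets lebesgue" by (simp only: negligible_iff_null_sets)
    then show ?thesis unfolding AE_LM_iff by (rule AE_I') (auto simp: Lam_def)
  qed
  then have "AE x in LM. (\<lambda>k. U k (cis (-x))) \<longlonglongrightarrow> H x"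
    using cont
  proof eventually_elim
    case (elim x)
    then have x: "x \<in> Lam" by (auto simp: Lam_def)
    show ?case
    proof (rule LIMSEQ_I)
      fix e :: real assume e: "e > 0"
      obtain d where d: "d > 0" "\<And>y. \<bar>y - x\<bar> < d \<Longrightarrow> \<bar>H y - H x\<bar> < e / 2"
        using elim(2) e unfolding continuous_at_eps_delta dist_real_def by (metis half_gt_zero)
      define C where "C = Lam \<inter> {y. d \<le> \<bar>y - x\<bar>}"
      have "compact C"
        unfolding C_def Lam_def
        by (intro compact_Int_closed closed_Collect_le continuous_intros) auto
      have "\<exists>\<eta>>0. \<forall>y\<in>C. \<eta> \<le> cmod (cis (-x) - cis (-y))"
      proof (cases "C = {}")
        case False
        have "continuous_on C (\<lambda>y. cmod (cis (-x) - cis (-y)))" by (intro continuous_intros)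
        then obtain y0 where y0: "y0 \<in> C" "\<forall>y\<in>C. cmod (cis (-x) - cis (-y0)) \<le> cmod (cis (-x) - cis (-y))"
          using continuous_attains_inf[OF \<open>compact C\<close> False] by blast
        have "y0 \<in> Lam" "x \<noteq> y0" using y0(1) d(1) by (auto simp: C_def)
        then have "cis (-x) \<noteq> cis (-y0)" using cis_eq_interior[OF elim(1)] by blast
        then have "cmod (cis (-x) - cis (-y0)) > 0" by (simp only: zero_less_norm_iff right_minus_eq not_False_eq_True)
        then show ?thesis using y0(2) by blast
      qed (auto intro: exI[of _ 1])
      then obtain \<eta> where \<eta>: "\<eta> > 0" "\<And>y. y \<in> C \<Longrightarrow> \<eta> \<le> cmod (cis (-x) - cis (-y))" by blast
      \<comment> \<open>From \<open>N\<close> on the penalty at distance \<open>\<eta>\<close> is at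
        least \<open>2 * K\<close>, the largest possible difference of two values of
        \<open>H\<close>.\<close>
      obtain N :: nat where N: "2 * K / \<eta> \<le> real N" using real_arch_simple by blast
      have "norm (U k (cis (-x)) - H x) < e" if k: "k \<ge> N" for k
      proof -
        have "H x - e / 2 \<le> U k (cis (-x))"
        proof (rule U_ge)
          fix y assume y: "y \<in> Lam"
          show "H x - e / 2 \<le> V k (cis (-x)) y"
          proof (cases "\<bar>y - x\<bar> < d")
            case True
            have "real k * cmod (cis (-x) - cis (-y)) \<ge> 0" by simp
            then show ?thesis unfolding V_def using d(2)[OF True] by linarith
          next
            case False
            then have "\<eta> \<le> cmod (cis (-x) - cis (-y))" using y by (intro \<eta>(2)) (auto simp: C_def)
            moreover have "2 * K / \<eta> \<le> real k" using N k by linarith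
            ultimately have "2 * K / \<eta> * \<eta> \<le> real k * cmod (cis (-x) - cis (-y))"
              using \<eta>(1) by (intro mult_mono) auto
            then have "2 * K \<le> real k * cmod (cis (-x) - cis (-y))" using \<eta>(1) by simp
            then show ?thesis unfolding V_def using bdd[rule_format, OF x] bdd[rule_format, OF y] e by linarith
          qed
        qed
        then show ?thesis using U_le_H[OF x, of k] e by simp
      qed
      then show "\<exists>N. \<forall>k\<ge>N. norm (U k (cis (-x)) - H x) < e" by blast
    qed
  qed
  then show ?thesis
    using that[of U] U_cont U_le_H U_ge[OF V_ge] by blast
qed

text \<open>The minorants exhibit \<open>H\<close> as an almost everywhere limit of continuous
  functions, which gives measurability.\<close>

lemma AE_continuous_integrable:
  fixes H :: "real \<Rightarrow> real"
  assumes bdd: "\<forall>x\<in>Lam. \<bar>H x\<bar> \<le> K" and cont: "AE x in LM. isCont H x"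
  shows "integrable LM H"
proof -
  obtain U :: "nat \<Rightarrow> complex \<Rightarrow> real" where U: "\<And>k. continuous_on UNIV (U k)"
    "\<And>k x. x \<in> Lam \<Longrightarrow> U k (cis (-x)) \<le> H x" "\<And>k z. - K \<le> U k z"
    "AE x in LM. (\<lambda>k. U k (cis (-x))) \<longlonglongrightarrow> H x"
    using circle_minorants[OF bdd cont] by blast
  have "(\<lambda>x. U k (cis (-x))) \<in> borel_measurable LM" for k
    by (intro continuous_measurable_LM continuous_on_compose2[OF U(1)] continuous_intros) auto
  then have "(\<lambda>x. lim (\<lambda>k. U k (cis (-x)))) \<in> borel_measurable LM" by measurable
  moreover have "AE x in LM. lim (\<lambda>k. U k (cis (-x))) = H x"
    using U(4) by eventually_elim (rule limI)
  ultimately have "H \<in> borel_measurable LM" by (rule measurable_LM_AE)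
  then show ?thesis using bdd by (intro LM.integrable_const_bound[of _ K] AE_I2) auto
qed

text \<open>The minorant is a Taylor polynomial of \<open>exp (P / 2)\<close>, where \<open>Re P\<close> approximates \<open>H\<close> from
  below on the circle: its value at \<open>0\<close> is then controlled by the mean of \<open>Re P\<close>.\<close>

lemma poly_minorant_exp:
  fixes H :: "real \<Rightarrow> real"
  assumes bdd: "\<forall>x\<in>Lam. \<bar>H x\<bar> \<le> K" and cont: "AE x in LM. isCont H x"
    and c: "0 < c" "c < exp (integral\<^sup>L LM H / (2 * pi))"
  obtains q where "\<And>x. x \<in> Lam \<Longrightarrow> (cmod (poly q (cis (-x))))\<^sup>2 \<le> exp (H x)"
    "c \<le> (cmod (poly q 0))\<^sup>2"
proof -
  obtain U :: "nat \<Rightarrow> complex \<Rightarrow> real" where U: "\<And>k. continuous_on UNIV (U k)"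
    "\<And>k x. x \<in> Lam \<Longrightarrow> U k (cis (-x)) \<le> H x" "\<And>k z. - K \<le> U k z"
    "AE x in LM. (\<lambda>k. U k (cis (-x))) \<longlonglongrightarrow> H x"
    using circle_minorants[OF bdd cont] by blast
  have H: "integrable LM H" by (rule AE_continuous_integrable[OF bdd cont])
  have U_cis: "continuous_on S (\<lambda>x. U k (cis (-x)))" for S k
    by (intro continuous_on_compose2[OF U(1)] continuous_intros) auto
  have "(\<lambda>k. integral\<^sup>L LM (\<lambda>x. U k (cis (-x)))) \<longlonglongrightarrow> integral\<^sup>L LM H"
  proof (rule integral_dominated_convergence[where w = "\<lambda>_. K"])
    show "AE x in LM. norm (U k (cis (-x))) \<le> K" for k
    proof (rule AE_I2)
      fix x assume "x \<in> space LM"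
      then have x: "x \<in> Lam" by simp
      show "norm (U k (cis (-x))) \<le> K"
        using U(2)[OF x, of k] U(3)[of k "cis (-x)"] bdd[rule_format, OF x] by (simp add: abs_le_iff)
    qed
  next
    show "(\<lambda>x. U k (cis (-x))) \<in> borel_measurable LM" for k
      by (intro continuous_measurable_LM U_cis)
  qed (use H U(4) in auto)
  \<comment> \<open>The margin \<open>d\<close> is spent as follows: \<open>d / 4\<close> on passing
    from \<open>H\<close> to \<open>U k\<close>, \<open>d / 4\<close> on passing to
    \<open>Re P\<close>, and \<open>d / 2\<close> on the Taylor polynomial and its
    rescaling.\<close>
  moreover define d where "d = integral\<^sup>L LM H / (2 * pi) - ln c"
  have d: "d > 0" using c using ln_less_cancel_iff[of c "exp (integral\<^sup>L LM H / (2 * pi))"] by (simp add: d_def)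
  ultimately have "\<forall>\<^sub>F k in sequentially. integral\<^sup>L LM (\<lambda>x. U k (cis (-x))) > integral\<^sup>L LM H - 2 * pi * (d / 4)"
    by (intro order_tendstoD) auto
  then obtain k where k: "integral\<^sup>L LM (\<lambda>x. U k (cis (-x))) > integral\<^sup>L LM H - 2 * pi * (d / 4)"
    using eventually_happens'[OF sequentially_bot] by blast
  \<comment> \<open>Lowering \<open>U k\<close> by \<open>d / 8\<close> before approximating it
    within \<open>d / 8\<close> keeps \<open>Re P\<close> below \<open>U k\<close>.\<close>
  have "continuous_on (sphere 0 1) (\<lambda>z. U k z - d / 8)"
    using U(1)[of k] by (intro continuous_intros) (auto intro: continuous_on_subset)
  then obtain P where P: "\<And>z. cmod z = 1 \<Longrightarrow> \<bar>U k z - d / 8 - Re (poly P z)\<bar> < d / 8"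
    using Stone_Weierstrass_circle[of _ "d / 8"] d by auto
  have P_cis: "\<bar>U k (cis (-x)) - d / 8 - Re (poly P (cis (-x)))\<bar> < d / 8" for x
    by (rule P) simp
  have P_le: "Re (poly P (cis (-x))) \<le> H x" if "x \<in> Lam" for x
    using P_cis[of x] U(2)[OF that, of k] by linarith
  have P0: "Re (poly P 0) \<ge> ln c + d / 2"
  proof -
    have "integral\<^sup>L LM (\<lambda>x. U k (cis (-x)) - d / 4) \<le> integral\<^sup>L LM (\<lambda>x. Re (poly P (cis (-x))))"
    proof (rule integral_mono)
      show "U k (cis (-x)) - d / 4 \<le> Re (poly P (cis (-x)))" for x
        using P_cis[of x] by linarith
    qed (intro continuous_integrable_LM continuous_intros U_cis)+
    moreover have "integral\<^sup>L LM (\<lambda>x. U k (cis (-x)) - d / 4) = integral\<^sup>L LM (\<lambda>x. U k (cis (-x))) - 2 * pi * (d / 4)"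
      using continuous_integrable_LM[OF U_cis] by (simp add: measure_LM)
    ultimately have "integral\<^sup>L LM H - 2 * pi * (d / 2) \<le> 2 * pi * Re (poly P 0)"
      using k unfolding integral_Re_poly_cis by simp
    then have "integral\<^sup>L LM H / (2 * pi) - d / 2 \<le> Re (poly P 0)"
      by (simp add: field_simps)
    then show ?thesis by (simp add: d_def field_simps)
  qed
  have "((\<lambda>e. ((1 - e) / (1 + e))\<^sup>2) \<longlongrightarrow> ((1 - 0) / (1 + 0))\<^sup>2) (at_right (0::real))"
    by (intro tendsto_intros) auto
  then have "\<forall>\<^sub>F e in at_right (0::real). exp (- d / 2) < ((1 - e) / (1 + e))\<^sup>2"
    using d by (intro order_tendstoD) auto
  moreover have "\<forall>\<^sub>F e in at_right (0::real). e \<in> {0<..<1}"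
    by (rule eventually_at_rightI[of 0 1]) auto
  ultimately have "\<forall>\<^sub>F e in at_right (0::real). exp (- d / 2) < ((1 - e) / (1 + e))\<^sup>2 \<and> 0 < e \<and> e < 1"
    by eventually_elim auto
  then obtain e :: real where e: "exp (- d / 2) < ((1 - e) / (1 + e))\<^sup>2" "0 < e" "e < 1"
    using eventually_happens'[OF trivial_limit_at_right_real] by blast
  let ?E = "\<lambda>z. exp (poly (smult (1/2) P) z)"
  have norm_E: "cmod (?E z) = exp (Re (poly P z) / 2)" for z by simp
  \<comment> \<open>The exponential has no zeros, so its modulus has a positive minimum
    \<open>b\<close>; an absolute error below \<open>e * b\<close> is a relative error below
    \<open>e\<close>.\<close>
  obtain b where b: "b > 0" "\<And>z. cmod z \<le> 1 \<Longrightarrow> b \<le> cmod (?E z)"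
  proof -
    have "continuous_on (cball 0 1) (\<lambda>z. cmod (?E z))" by (intro continuous_intros)
    then obtain z0 where "\<forall>z\<in>cball 0 1. cmod (?E z0) \<le> cmod (?E z)"
      using continuous_attains_inf[of "cball (0::complex) 1" "\<lambda>z. cmod (?E z)"] by force
    then show ?thesis using that[of "cmod (?E z0)"] by auto
  qed
  obtain q where q: "\<And>z. cmod z \<le> 1 \<Longrightarrow> cmod (poly q z - ?E z) < e * b"
    using exp_poly_approx[of "e * b" "smult (1/2) P"] e(2) b(1) by auto
  have q_bound: "cmod (poly q z - ?E z) \<le> e * cmod (?E z)" if "cmod z \<le> 1" for z
    using q[OF that] mult_left_mono[OF b(2)[OF that], of e] e by linarith
  have upper: "cmod (poly q z) \<le> (1 + e) * cmod (?E z)" if "cmod z \<le> 1" for z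
    using q_bound[OF that] norm_triangle_ineq2[of "poly q z" "?E z"] by (simp add: algebra_simps)
  have lower: "(1 - e) * cmod (?E z) \<le> cmod (poly q z)" if "cmod z \<le> 1" for z
    using q_bound[OF that] norm_triangle_ineq2[of "?E z" "poly q z"]
    by (simp add: algebra_simps norm_minus_commute)
  \<comment> \<open>Division by \<open>1 + e\<close> restores the bound on the circle and lowers the
    estimate at \<open>0\<close> to the factor \<open>(1 - e) / (1 + e)\<close>.\<close>
  define r where "r = smult (of_real (inverse (1 + e))) q"
  have r: "cmod (poly r z) = cmod (poly q z) / (1 + e)" for z
    unfolding r_def poly_smult norm_mult norm_of_real using e by (simp add: field_simps)
  have sq: "(exp (s / 2))\<^sup>2 = exp s" for s :: real by (simp add: power2_eq_square flip: exp_add)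
  show ?thesis
  proof (rule that[of r])
    fix x assume x: "x \<in> Lam"
    have "cmod (poly r (cis (-x))) \<le> exp (Re (poly P (cis (-x))) / 2)"
      using upper[of "cis (-x)"] e unfolding r norm_E by (simp add: field_simps)
    then have "(cmod (poly r (cis (-x))))\<^sup>2 \<le> (exp (Re (poly P (cis (-x))) / 2))\<^sup>2"
      by (intro power_mono) auto
    also have "\<dots> \<le> exp (H x)" unfolding sq using P_le[OF x] by simp
    finally show "(cmod (poly r (cis (-x))))\<^sup>2 \<le> exp (H x)" .
  next
    have "c = exp (- d / 2) * exp (ln c + d / 2)" using c by (simp flip: exp_add)
    also have "\<dots> \<le> ((1 - e) / (1 + e))\<^sup>2 * exp (Re (poly P 0))"
      using e P0 by (intro mult_mono) auto
    also have "\<dots> = ((1 - e) / (1 + e) * exp (Re (poly P 0) / 2))\<^sup>2"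
      by (simp only: power_mult_distrib sq)
    also have "\<dots> \<le> (cmod (poly r 0))\<^sup>2"
    proof (rule power_mono)
      show "(1 - e) / (1 + e) * exp (Re (poly P 0) / 2) \<le> cmod (poly r 0)"
        using lower[of 0] e unfolding r norm_E by (simp add: divide_right_mono)
    qed (use e in auto)
    finally show "c \<le> (cmod (poly r 0))\<^sup>2" .
  qed
qed

text \<open>Take \<open>p\<close> proportional to \<open>A * b * q\<close>, where \<open>q\<close>
  is the minorant for \<open>exp H\<close> and \<open>b\<close> an approximate inverse of
  \<open>B\<close>. At \<open>0\<close> only \<open>q\<close> matters, since \<open>A\<close> and
  \<open>b\<close> have modulus \<open>1\<close> there. The gap between \<open>c\<close> and
  \<open>c'\<close> pays for the factor \<open>(1 + e)\<^sup>2\<close>.\<close>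

lemma poly_minorant_ratio:
  fixes H :: "real \<Rightarrow> real"
  assumes bdd: "\<forall>x\<in>Lam. \<bar>H x\<bar> \<le> K" and cont: "AE x in LM. isCont H x"
    and c: "0 < c" "c < exp (integral\<^sup>L LM H / (2 * pi))"
    and A: "unit_roots A" and B: "unit_roots B"
  obtains p where "\<And>x. x \<in> Lam \<Longrightarrow> (cmod (poly p (cis (-x))))\<^sup>2 * (cmod (poly B (cis (-x))))\<^sup>2
      \<le> exp (H x) * (cmod (poly A (cis (-x))))\<^sup>2"
    "c \<le> (cmod (poly p 0))\<^sup>2"
proof -
  obtain c' where c': "c < c'" "c' < exp (integral\<^sup>L LM H / (2 * pi))" using dense c(2) by blast
  obtain q where q: "\<And>x. x \<in> Lam \<Longrightarrow> (cmod (poly q (cis (-x))))\<^sup>2 \<le> exp (H x)"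
    "c' \<le> (cmod (poly q 0))\<^sup>2"
    by (rule poly_minorant_exp[OF bdd cont less_trans[OF c(1) c'(1)] c'(2)]) blast
  define e where "e = sqrt (c' / c) - 1"
  have e: "e > 0" "(1 + e)\<^sup>2 = c' / c" using c c' by (simp_all add: e_def)
  obtain b where b: "poly b 0 = 1" "\<And>z. cmod z = 1 \<Longrightarrow> cmod (poly b z * poly B z) \<le> 1 + e"
    using unit_roots_approx_inverse[OF B e(1)] by blast
  define p where "p = smult (of_real (inverse (1 + e))) (A * b * q)"
  have p: "(cmod (poly p z))\<^sup>2 = (cmod (poly A z))\<^sup>2 * (cmod (poly b z))\<^sup>2 * (cmod (poly q z))\<^sup>2 * (c / c')" for z
  proof -
    have "cmod (poly p z) = cmod (poly A z) * cmod (poly b z) * cmod (poly q z) * inverse (1 + e)"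
      using e(1) by (simp add: p_def norm_mult norm_of_real del: of_real_inverse of_real_add)
    then show ?thesis
      by (simp add: power_mult_distrib e(2) power_inverse)
  qed
  show ?thesis
  proof (rule that[of p])
    fix x assume x: "x \<in> Lam"
    have "(cmod (poly b (cis (-x)) * poly B (cis (-x))))\<^sup>2 \<le> (1 + e)\<^sup>2"
      by (intro power_mono b(2)) auto
    then have bB: "(cmod (poly b (cis (-x))))\<^sup>2 * (cmod (poly B (cis (-x))))\<^sup>2 * (c / c') \<le> 1"
      using c c' unfolding e(2) by (simp add: norm_mult power_mult_distrib field_simps)
    have "(cmod (poly p (cis (-x))))\<^sup>2 * (cmod (poly B (cis (-x))))\<^sup>2 =
       (cmod (poly A (cis (-x))))\<^sup>2 * ((cmod (poly q (cis (-x))))\<^sup>2 *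
       ((cmod (poly b (cis (-x))))\<^sup>2 * (cmod (poly B (cis (-x))))\<^sup>2 * (c / c')))"
      unfolding p by (simp only: mult_ac)
    also have "\<dots> \<le> (cmod (poly A (cis (-x))))\<^sup>2 * (exp (H x) * 1)"
      using c c' by (intro mult_left_mono mult_mono q(1)[OF x] bB) auto
    finally show "(cmod (poly p (cis (-x))))\<^sup>2 * (cmod (poly B (cis (-x))))\<^sup>2
      \<le> exp (H x) * (cmod (poly A (cis (-x))))\<^sup>2" by (simp add: mult.commute)
  next
    have "c = c' * (c / c')" using c c' by simp
    also have "\<dots> \<le> (cmod (poly q 0))\<^sup>2 * (c / c')" using q(2) c c' by (intro mult_right_mono) auto
    also have "\<dots> = (cmod (poly p 0))\<^sup>2" unfolding p by (simp add: unit_roots_cmod_0[OF A] b(1))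
    finally show "c \<le> (cmod (poly p 0))\<^sup>2" .
  qed
qed

section \<open>Asymptotics of the prediction errors\<close>

lemma ratio_shift_tendsto_1:
  fixes s :: "nat \<Rightarrow> real"
  assumes "\<And>n. s n > 0" "(\<lambda>n. s (Suc n) / s n) \<longlonglongrightarrow> 1"
  shows "(\<lambda>n. s (n + m) / s n) \<longlonglongrightarrow> 1"
proof (induction m)
  case 0
  have "s n \<noteq> 0" for n using assms(1)[of n] by simp
  then show ?case by simp
next
  case (Suc m)
  have "(\<lambda>n. s (Suc (n + m)) / s (n + m) * (s (n + m) / s n)) \<longlonglongrightarrow> 1 * 1"
    using LIMSEQ_ignore_initial_segment[OF assms(2), of m] Suc.IH by (rule tendsto_mult)
  moreover have "s (Suc (n + m)) / s (n + m) * (s (n + m) / s n) = s (n + Suc m) / s n" for n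
    using assms(1)[of "n + m"] by simp
  ultimately show ?case by (simp only: mult_1)
qed

text \<open>The shift \<open>m\<close> may depend on \<open>c\<close> but is fixed while
  \<open>n\<close> grows, so \<open>s (n + m) / s n\<close> tends to \<open>1\<close> and the shift
  disappears in the limit; then \<open>c\<close> approaches its bound.\<close>

lemma ratio_tendsto_shift_bounds:
  fixes r s :: "nat \<Rightarrow> real"
  assumes s: "\<And>n. s n > 0" "(\<lambda>n. s (Suc n) / s n) \<longlonglongrightarrow> 1" and L: "L > 0"
    and lower: "\<And>c. 0 < c \<Longrightarrow> c < L \<Longrightarrow> \<exists>m. \<forall>n. c * s (n + m) \<le> r n"
    and upper: "\<And>c. 0 < c \<Longrightarrow> c < 1 / L \<Longrightarrow> \<exists>m. \<forall>n. c * r (n + m) \<le> s n"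
  shows "(\<lambda>n. r n / s n) \<longlonglongrightarrow> L"
proof (rule order_tendstoI)
  fix a assume "a < L"
  then have "max a 0 < L" using L by simp
  then obtain c where "max a 0 < c" "c < L" using dense by blast
  then have c: "a < c" "0 < c" "c < L" by auto
  obtain m where m: "\<And>n. c * s (n + m) \<le> r n" using lower[OF c(2,3)] by blast
  have "(\<lambda>n. c * (s (n + m) / s n)) \<longlonglongrightarrow> c * 1"
    by (intro tendsto_intros ratio_shift_tendsto_1 s)
  then have "\<forall>\<^sub>F n in sequentially. a < c * (s (n + m) / s n)"
    using c by (intro order_tendstoD) auto
  then show "\<forall>\<^sub>F n in sequentially. a < r n / s n"
  proof eventually_elim
    case (elim n)
    have "c * (s (n + m) / s n) \<le> r n / s n"
      using m[of n] s(1)[of n] by (simp add: divide_right_mono)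
    with elim show ?case by simp
  qed
next
  fix b assume b: "L < b"
  then have "1 / b < 1 / L" using L by (simp add: divide_strict_left_mono)
  then obtain c where c: "1 / b < c" "c < 1 / L" using dense by blast
  have "0 < 1 / b" using b L by simp
  then have c0: "0 < c" using c by linarith
  have cb: "1 / c < b" using c b L c0 by (simp add: field_simps)
  obtain m where m: "\<And>n. c * r (n + m) \<le> s n" using upper[OF c0 c(2)] by blast
  have "(\<lambda>n. 1 / c * inverse (s (n + m) / s n)) \<longlonglongrightarrow> 1 / c * inverse 1"
    by (intro tendsto_intros ratio_shift_tendsto_1 s) simp
  then have "\<forall>\<^sub>F n in sequentially. 1 / c * inverse (s (n + m) / s n) < b"
    using cb by (intro order_tendstoD) auto
  \<comment> \<open>The second bound controls \<open>r\<close> at the shifted index, so the estimate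
    is proved there and then reindexed.\<close>
  then have "\<forall>\<^sub>F n in sequentially. r (n + m) / s (n + m) < b"
  proof eventually_elim
    case (elim n)
    have "r (n + m) \<le> s n / c" using m[of n] c0 by (simp add: field_simps)
    then have "r (n + m) / s (n + m) \<le> s n / c / s (n + m)"
      using s(1)[of "n + m"] by (intro divide_right_mono) auto
    also have "\<dots> = 1 / c * inverse (s (n + m) / s n)" by simp
    finally show ?case using elim by simp
  qed
  then show "\<forall>\<^sub>F n in sequentially. r n / s n < b"
    using eventually_sequentially_seg[of "\<lambda>n. r n / s n < b" m] by blast
qed

lemma sigma_ratio_tendsto_1:
  assumes "\<And>x. x \<in> Lam \<Longrightarrow> F x \<ge> 0" "(\<lambda>n. sigma F (Suc n) / sigma F n) \<longlonglongrightarrow> 1"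
  shows "sigma2 F n > 0" "(\<lambda>n. sigma2 F (Suc n) / sigma2 F n) \<longlonglongrightarrow> 1"
proof -
  have "(\<lambda>n. (sigma F (Suc n) / sigma F n)\<^sup>2) \<longlonglongrightarrow> 1\<^sup>2"
    by (intro tendsto_intros assms)
  then show lim: "(\<lambda>n. sigma2 F (Suc n) / sigma2 F n) \<longlonglongrightarrow> 1"
    using sigma2_nonneg[of F] assms(1) by (simp add: sigma_def power_divide)
  have dec: "sigma2 F n \<le> sigma2 F k" if "k \<le> n" for n k :: nat
    unfolding sigma2_eq_Inf_poly using that assms(1)
    by (intro cINF_superset_mono sigma2_bdd_below) (auto intro!: exI[of _ 1])
  show "sigma2 F n > 0"
  proof (rule ccontr)
    assume "\<not> sigma2 F n > 0"
    then have "\<forall>k\<ge>n. sigma2 F k = 0"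
      using dec sigma2_nonneg[of F] assms(1) by (metis order.antisym order.trans not_less)
    \<comment> \<open>The errors decrease, so one zero forces all later ones to vanish; then
      \<open>0 / 0 = 0\<close> contradicts the limit \<open>1\<close>.\<close>
    then have "\<forall>\<^sub>F k in sequentially. sigma2 F (Suc k) / sigma2 F k = 0"
      unfolding eventually_sequentially by auto
    then have "(\<lambda>n. sigma2 F (Suc n) / sigma2 F n) \<longlonglongrightarrow> 0"
      by (rule tendsto_eventually)
    with lim show False using LIMSEQ_unique zero_neq_one by blast
  qed
qed

text \<open>A polynomial \<open>p\<close> with \<open>|p|\<^sup>2 \<le> g\<close> bounds the error
  of \<open>f * g\<close> from below, and one with \<open>|p|\<^sup>2 * g \<le> 1\<close> bounds it
  from above; \<open>poly_minorant_ratio\<close> yields both.\<close>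

lemma sigma2_ratio_limit:
  fixes f g H :: "real \<Rightarrow> real"
  assumes f: "integrable LM f" "\<And>x. x \<in> Lam \<Longrightarrow> f x \<ge> 0"
      "(\<lambda>n. sigma f (Suc n) / sigma f n) \<longlonglongrightarrow> 1"
    and bdd: "\<forall>x\<in>Lam. \<bar>H x\<bar> \<le> K" and cont: "AE x in LM. isCont H x"
    and A: "unit_roots A" and B: "unit_roots B"
    and g: "\<And>x. x \<in> Lam \<Longrightarrow> g x = exp (H x) * (cmod (poly A (cis (-x))))\<^sup>2 / (cmod (poly B (cis (-x))))\<^sup>2"
    and fg: "integrable LM (\<lambda>x. f x * g x)"
  shows "(\<lambda>n. sigma2 (\<lambda>x. f x * g x) n / sigma2 f n) \<longlonglongrightarrow> exp (integral\<^sup>L LM H / (2 * pi))"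
proof (rule ratio_tendsto_shift_bounds)
  have g0: "g x \<ge> 0" if "x \<in> Lam" for x unfolding g[OF that] by simp
  show "sigma2 f n > 0" for n by (rule sigma_ratio_tendsto_1(1)[OF f(2,3)])
  show "(\<lambda>n. sigma2 f (Suc n) / sigma2 f n) \<longlonglongrightarrow> 1" by (rule sigma_ratio_tendsto_1(2)[OF f(2,3)])
  show "0 < exp (integral\<^sup>L LM H / (2 * pi))" by simp
  show "\<exists>m. \<forall>n. c * sigma2 f (n + m) \<le> sigma2 (\<lambda>x. f x * g x) n"
    if c: "0 < c" "c < exp (integral\<^sup>L LM H / (2 * pi))" for c
  proof -
    obtain p where p: "\<And>x. x \<in> Lam \<Longrightarrow> (cmod (poly p (cis (-x))))\<^sup>2 * (cmod (poly B (cis (-x))))\<^sup>2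
        \<le> exp (H x) * (cmod (poly A (cis (-x))))\<^sup>2" "c \<le> (cmod (poly p 0))\<^sup>2"
      using poly_minorant_ratio[OF bdd cont c A B] by blast
    have p0: "poly p 0 \<noteq> 0" using p(2) c by auto
    have "AE x in LM. x \<in> Lam" using AE_space[of LM] by simp
    then have "AE x in LM. (cmod (poly p (cis (-x))))\<^sup>2 * f x \<le> f x * g x"
      using unit_roots_AE_nonzero[OF B]
    proof eventually_elim
      case (elim x)
      then have "(cmod (poly p (cis (-x))))\<^sup>2 \<le> g x"
        using p(1)[OF elim(1)] unfolding g[OF elim(1)] by (simp add: pos_le_divide_eq)
      then show ?case using f(2)[OF elim(1)] by (simp add: mult.commute mult_left_mono)
    qed
    then have "(cmod (poly p 0))\<^sup>2 * sigma2 f (n + degree p) \<le> sigma2 (\<lambda>x. f x * g x) n" for n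
      by (intro sigma2_transfer f fg p0) auto
    moreover have "c * sigma2 f k \<le> (cmod (poly p 0))\<^sup>2 * sigma2 f k" for k
      using p(2) sigma2_nonneg[OF f(2)] by (intro mult_right_mono) auto
    ultimately show ?thesis using order_trans by blast
  qed
  show "\<exists>m. \<forall>n. c * sigma2 (\<lambda>x. f x * g x) (n + m) \<le> sigma2 f n"
    if c: "0 < c" "c < 1 / exp (integral\<^sup>L LM H / (2 * pi))" for c
  proof -
    \<comment> \<open>Passing to \<open>1 / g\<close> replaces \<open>H\<close> by
      \<open>- H\<close> and exchanges \<open>A\<close> and \<open>B\<close>.\<close>
    have bdd': "\<forall>x\<in>Lam. \<bar>- H x\<bar> \<le> K" using bdd by simp
    have cont': "AE x in LM. isCont (\<lambda>x. - H x) x"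
      using cont by eventually_elim (intro continuous_intros)
    have c': "c < exp (integral\<^sup>L LM (\<lambda>x. - H x) / (2 * pi))"
    proof -
      have "integral\<^sup>L LM (\<lambda>x. - H x) / (2 * pi) = - (integral\<^sup>L LM H / (2 * pi))" by simp
      then show ?thesis using c(2) by (simp only: exp_minus inverse_eq_divide)
    qed
    have fg0: "f x * g x \<ge> 0" if "x \<in> Lam" for x using f(2)[OF that] g0[OF that] by simp
    obtain p where p: "\<And>x. x \<in> Lam \<Longrightarrow> (cmod (poly p (cis (-x))))\<^sup>2 * (cmod (poly A (cis (-x))))\<^sup>2
        \<le> exp (- H x) * (cmod (poly B (cis (-x))))\<^sup>2" "c \<le> (cmod (poly p 0))\<^sup>2"
      using poly_minorant_ratio[OF bdd' cont' c(1) c' B A] by blast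
    have p0: "poly p 0 \<noteq> 0" using p(2) c by auto
    have "AE x in LM. x \<in> Lam" using AE_space[of LM] by simp
    then have "AE x in LM. (cmod (poly p (cis (-x))))\<^sup>2 * (f x * g x) \<le> f x"
      using unit_roots_AE_nonzero[OF B]
    proof eventually_elim
      case (elim x)
      have "exp (H x) * ((cmod (poly p (cis (-x))))\<^sup>2 * (cmod (poly A (cis (-x))))\<^sup>2)
          \<le> exp (H x) * (exp (- H x) * (cmod (poly B (cis (-x))))\<^sup>2)"
        using p(1)[OF elim(1)] by (intro mult_left_mono) auto
      also have "\<dots> = (cmod (poly B (cis (-x))))\<^sup>2" by (simp add: exp_minus)
      finally have "(cmod (poly p (cis (-x))))\<^sup>2 * g x \<le> 1"
        using elim(2) unfolding g[OF elim(1)] by (simp add: divide_le_eq mult_ac)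
      then have "f x * ((cmod (poly p (cis (-x))))\<^sup>2 * g x) \<le> f x * 1"
        using f(2)[OF elim(1)] by (rule mult_left_mono)
      then show ?case by (simp add: mult_ac)
    qed
    then have "(cmod (poly p 0))\<^sup>2 * sigma2 (\<lambda>x. f x * g x) (n + degree p) \<le> sigma2 f n" for n
      by (intro sigma2_transfer f fg fg0 p0) auto
    moreover have "c * sigma2 (\<lambda>x. f x * g x) k \<le> (cmod (poly p 0))\<^sup>2 * sigma2 (\<lambda>x. f x * g x) k" for k
      using p(2) sigma2_nonneg[OF fg0] by (intro mult_right_mono) auto
    ultimately show ?thesis using order_trans by blast
  qed
qed

section \<open>Geometric means and the final assembly\<close>

lemma G_pos_iff:
  "G u > 0 \<longleftrightarrow> (AE x in LM. u x > 0) \<and> integrable LM (\<lambda>x. ln (u x))"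
  by (simp add: G_def AE_LM_iff L1_iff)

lemma G_eq_0_iff: "G u = 0 \<longleftrightarrow> \<not> G u > 0"
  by (auto simp: G_def)

text \<open>Almost everywhere \<open>ln g\<close> is \<open>H\<close> plus the logarithm for
  \<open>A\<close> minus the one for \<open>B\<close>, and the last two have mean
  \<open>0\<close>.\<close>

lemma G_exp_unit_roots:
  assumes H: "integrable LM H" and A: "unit_roots A" and B: "unit_roots B"
    and g: "\<And>x. x \<in> Lam \<Longrightarrow> g x = exp (H x) * (cmod (poly A (cis (-x))))\<^sup>2 / (cmod (poly B (cis (-x))))\<^sup>2"
  shows "G g = exp (integral\<^sup>L LM H / (2 * pi))"
proof -
  let ?a = "\<lambda>x. ln ((cmod (poly A (cis (-x))))\<^sup>2)" and ?b = "\<lambda>x. ln ((cmod (poly B (cis (-x))))\<^sup>2)"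
  have int: "integrable LM (\<lambda>x. H x + ?a x - ?b x)"
    using H unit_roots_integral_ln[OF A] unit_roots_integral_ln[OF B] by auto
  have eq: "integral\<^sup>L LM (\<lambda>x. H x + ?a x - ?b x) = integral\<^sup>L LM H"
    using H unit_roots_integral_ln[OF A] unit_roots_integral_ln[OF B] by simp
  have inL: "AE x in LM. x \<in> Lam" using AE_space[of LM] by simp
  have ae: "AE x in LM. H x + ?a x - ?b x = ln (g x)"
    using inL unit_roots_AE_nonzero[OF A] unit_roots_AE_nonzero[OF B]
    by eventually_elim (simp add: g ln_div ln_mult)
  have pos: "AE x in LM. g x > 0"
    using inL unit_roots_AE_nonzero[OF A] unit_roots_AE_nonzero[OF B]
    by eventually_elim (simp add: g)
  show ?thesis
    using integrable_LM_AE[OF int ae] pos unfolding eq by (simp add: G_def AE_LM_iff L1_iff Lint_eq)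
qed

text \<open>Otherwise \<open>ln f\<close>, as the difference of the integrable functions
  \<open>ln (f * g)\<close> and \<open>ln g\<close>, would be integrable.\<close>

lemma G_mult_eq_0:
  assumes f: "G f = 0" and g: "G g > 0"
  shows "G (\<lambda>x. f x * g x) = 0"
proof (rule ccontr)
  assume "G (\<lambda>x. f x * g x) \<noteq> 0"
  then have fg: "AE x in LM. f x * g x > 0" "integrable LM (\<lambda>x. ln (f x * g x))"
    by (simp_all only: G_eq_0_iff G_pos_iff not_not)
  have gp: "AE x in LM. g x > 0" "integrable LM (\<lambda>x. ln (g x))"
    using g by (simp_all only: G_pos_iff)
  have fp: "AE x in LM. f x > 0"
    using fg(1) gp(1) by eventually_elim (simp add: zero_less_mult_iff)
  have int: "integrable LM (\<lambda>x. ln (f x * g x) - ln (g x))" using fg(2) gp(2) by simp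
  have "AE x in LM. ln (f x * g x) - ln (g x) = ln (f x)"
    using fp gp(1) by eventually_elim (simp add: ln_mult)
  with int have "integrable LM (\<lambda>x. ln (f x))" by (rule integrable_LM_AE(1))
  then have "G f > 0" using fp by (simp add: G_pos_iff)
  then show False using f by simp
qed

lemma sphere_function_bounds:
  fixes W :: "complex \<Rightarrow> real"
  assumes "continuous_on (sphere 0 1) W" "\<And>z. cmod z = 1 \<Longrightarrow> W z > 0"
  obtains K where "\<And>x. \<bar>ln (W (cis (-x)))\<bar> \<le> K" "\<And>x. isCont (\<lambda>x. ln (W (cis (-x)))) x"
proof -
  have pos: "z \<in> sphere 0 1 \<Longrightarrow> W z \<noteq> 0" for z using assms(2)[of z] by auto
  have c: "continuous_on (sphere 0 1) (\<lambda>z. ln (W z))"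
    using pos by (intro continuous_intros assms(1)) auto
  then have "compact ((\<lambda>z. ln (W z)) ` sphere 0 1)"
    by (rule compact_continuous_image) auto
  then obtain K where K: "\<And>z. z \<in> sphere 0 1 \<Longrightarrow> norm (ln (W z)) \<le> K"
    using compact_imp_bounded bounded_iff by (metis imageI)
  have "\<bar>ln (W (cis (-x)))\<bar> \<le> K" for x using K[of "cis (-x)"] by simp
  moreover have "continuous_on UNIV (\<lambda>x. ln (W (cis (-x))))"
    by (intro continuous_on_compose2[OF c] continuous_intros) auto
  then have "isCont (\<lambda>x. ln (W (cis (-x)))) x" for x
    by (simp add: continuous_on_eq_continuous_at)
  ultimately show ?thesis using that by blast
qed

theorem mainTheorem11:
  fixes f h t1 t2 :: "real \<Rightarrow> real"
  assumes "f \<in> classF"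
    and "h \<in> classBpm"
    and "trig_poly t1" and "\<forall>x\<in>Lam. t1 x \<ge> 0" and "\<exists>x\<in>Lam. t1 x \<noteq> 0"
    and "trig_poly t2" and "\<forall>x\<in>Lam. t2 x \<ge> 0" and "\<exists>x\<in>Lam. t2 x \<noteq> 0"
    and "L1 (\<lambda>x. f x * (h x * t1 x / t2 x))"
  shows "(\<lambda>x. h x * t1 x / t2 x) \<in> classM f
       \<and> (\<lambda>x. f x * (h x * t1 x / t2 x)) \<in> classF
       \<and> (\<lambda>n. sigma2 (\<lambda>x. f x * (h x * t1 x / t2 x)) n / sigma2 f n)
            \<longlonglongrightarrow> G (\<lambda>x. h x * t1 x / t2 x)"
proof -
  have f: "integrable LM f" "\<And>x. x \<in> Lam \<Longrightarrow> f x \<ge> 0" "G f = 0"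
    "(\<lambda>n. sigma f (Suc n) / sigma f n) \<longlonglongrightarrow> 1"
    using assms(1) by (auto simp: classF_def L1_iff)
  obtain m M where mM: "0 < m" "\<And>x. x \<in> Lam \<Longrightarrow> m \<le> h x \<and> h x \<le> M"
    using assms(2) by (auto simp: classBpm_def)
  have "riemann_integrable_on h (-pi) pi" using assms(2) by (auto simp: classBpm_def classB_def)
  from riemann_integrable_AE_isCont[OF this] have h_cont: "AE x in LM. isCont h x"
    unfolding AE_LM_iff by (simp add: Lam_def)
  obtain A W1 where A: "unit_roots A" and W1: "continuous_on (sphere 0 1) W1" "\<And>z. cmod z = 1 \<Longrightarrow> W1 z > 0"
    and t1: "\<And>x. x \<in> Lam \<Longrightarrow> t1 x = (cmod (poly A (cis (-x))))\<^sup>2 * W1 (cis (-x))"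
    using trig_poly_factor[OF assms(3-5)] by blast
  obtain B W2 where B: "unit_roots B" and W2: "continuous_on (sphere 0 1) W2" "\<And>z. cmod z = 1 \<Longrightarrow> W2 z > 0"
    and t2: "\<And>x. x \<in> Lam \<Longrightarrow> t2 x = (cmod (poly B (cis (-x))))\<^sup>2 * W2 (cis (-x))"
    using trig_poly_factor[OF assms(6-8)] by blast
  obtain K1 where K1: "\<And>x. \<bar>ln (W1 (cis (-x)))\<bar> \<le> K1" "\<And>x. isCont (\<lambda>x. ln (W1 (cis (-x)))) x"
    using sphere_function_bounds[OF W1] by blast
  obtain K2 where K2: "\<And>x. \<bar>ln (W2 (cis (-x)))\<bar> \<le> K2" "\<And>x. isCont (\<lambda>x. ln (W2 (cis (-x)))) x"
    using sphere_function_bounds[OF W2] by blast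
  \<comment> \<open>\<open>H\<close> collects \<open>h\<close> and the zero-free parts of
    \<open>t1\<close> and \<open>t2\<close>; the zeros on the circle remain in \<open>A\<close> and
    \<open>B\<close>.\<close>
  define H where "H x = ln (h x) + ln (W1 (cis (-x))) - ln (W2 (cis (-x)))" for x
  define g where "g x = h x * t1 x / t2 x" for x
  have bdd: "\<forall>x\<in>Lam. \<bar>H x\<bar> \<le> max \<bar>ln m\<bar> \<bar>ln M\<bar> + K1 + K2"
  proof
    fix x assume x: "x \<in> Lam"
    have "ln m \<le> ln (h x)" "ln (h x) \<le> ln M" using mM(1) mM(2)[OF x] by auto
    then show "\<bar>H x\<bar> \<le> max \<bar>ln m\<bar> \<bar>ln M\<bar> + K1 + K2"
      using K1(1)[of x] K2(1)[of x] unfolding H_def by linarith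
  qed
  have inL: "AE x in LM. x \<in> Lam" using AE_space[of LM] by simp
  have cont: "AE x in LM. isCont H x"
    using h_cont inL
  proof eventually_elim
    case (elim x)
    have "h x \<noteq> 0" using mM(1) mM(2)[OF elim(2)] by simp
    then have "isCont (\<lambda>x. ln (h x)) x" using elim(1) by (intro isCont_ln')
    then show ?case unfolding H_def by (intro isCont_add isCont_diff K1(2) K2(2))
  qed
  have g_eq: "g x = exp (H x) * (cmod (poly A (cis (-x))))\<^sup>2 / (cmod (poly B (cis (-x))))\<^sup>2" if x: "x \<in> Lam" for x
  proof -
    have "h x > 0" using mM(1) mM(2)[OF x] by simp
    then have "exp (H x) = h x * W1 (cis (-x)) / W2 (cis (-x))"
      using W1(2)[of "cis (-x)"] W2(2)[of "cis (-x)"] by (simp add: H_def exp_add exp_diff)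
    then show ?thesis by (simp add: g_def t1[OF x] t2[OF x] mult_ac)
  qed
  have fg: "integrable LM (\<lambda>x. f x * g x)" using assms(9) by (simp add: L1_iff g_def)
  have G_g: "G g = exp (integral\<^sup>L LM H / (2 * pi))"
    by (rule G_exp_unit_roots[OF AE_continuous_integrable[OF bdd cont] A B g_eq])
  then have G_pos: "G g > 0" by simp
  have lim: "(\<lambda>n. sigma2 (\<lambda>x. f x * g x) n / sigma2 f n) \<longlonglongrightarrow> G g"
    unfolding G_g by (rule sigma2_ratio_limit[OF f(1,2,4) bdd cont A B g_eq fg])
  have g0: "g x \<ge> 0" if "x \<in> Lam" for x unfolding g_eq[OF that] by simp
  have fg0: "f x * g x \<ge> 0" if "x \<in> Lam" for x using f(2)[OF that] g0[OF that] by simp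
  have "g \<in> classM f"
    using g0 G_pos fg lim by (simp add: classM_def L1_iff)
  moreover have "(\<lambda>x. f x * g x) \<in> classF"
  proof -
    let ?r = "sigma2 (\<lambda>x. f x * g x)" and ?s = "sigma2 f"
    note s = sigma_ratio_tendsto_1[OF f(2,4)]
    \<comment> \<open>The successive ratio for \<open>f * g\<close> is rewritten through the ratio
      to \<open>f\<close> at \<open>n\<close> and at \<open>Suc n\<close>, both tending to
      \<open>G g\<close>, and the successive ratio for \<open>f\<close>, tending to
      \<open>1\<close>.\<close>
    have "(\<lambda>n. ?r (Suc n) / ?s (Suc n) * (?s (Suc n) / ?s n) / (?r n / ?s n)) \<longlonglongrightarrow> G g * 1 / G g"
      using G_pos by (intro tendsto_intros lim s(2) LIMSEQ_Suc[OF lim]) auto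
    moreover have "?r (Suc n) / ?s (Suc n) * (?s (Suc n) / ?s n) / (?r n / ?s n) = ?r (Suc n) / ?r n" for n
      using s(1)[of n] s(1)[of "Suc n"] by simp
    moreover have "G g * 1 / G g = 1" using G_pos by simp
    ultimately have "(\<lambda>n. ?r (Suc n) / ?r n) \<longlonglongrightarrow> 1" by (simp only:)
    then have "(\<lambda>n. sqrt (?r (Suc n) / ?r n)) \<longlonglongrightarrow> sqrt 1" by (rule tendsto_real_sqrt)
    then have "(\<lambda>n. sigma (\<lambda>x. f x * g x) (Suc n) / sigma (\<lambda>x. f x * g x) n) \<longlonglongrightarrow> 1"
      by (simp add: sigma_def real_sqrt_divide)
    then show ?thesis
      using fg fg0 G_mult_eq_0[OF f(3) G_pos] by (simp add: classF_def L1_iff)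
  qed
  ultimately show ?thesis using lim unfolding g_def by blast
qed

end
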